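(* Let $d\ge 2$, and let $\mu$ be a compactly supported Borel probability measure on $\mathbb{R}^d$. (1) For $\mu$-almost all $x\in\mathbb{R}^d$, $$\dim_{\mathrm H} D_x(\operatorname{supp}\mu)\ge\min\left\{\frac{\dim_{\mathrm F}\mu}{2},1\right\}.$$ Moreover, if $\dim_{\mathrm F}\mu>2$, then $\mathcal{L}^1\bigl(D_x(\operatorname{supp}\mu)\bigr)>0$ for $\mu$-almost all $x\in\mathbb{R}^d$. (2) Fix $\theta\in(0,1]$. Then $$\dim_{\mathrm H} D_x(\operatorname{supp}\mu)\ge\min\left\{\frac{\dim_{\mathrm F}^{\theta}\mu-d\theta}{2},1\right\}\quad\text{for }\mu\text{-almost all }x\in\mathbb{R}^d.$$ In particular, if $\dim_{\mathrm F}^{\theta}\mu>2+d\theta$, then $\mathcal{L}^1\bigl(D_x(\operatorname{supp}\mu)\bigr)>0$ for $\mu$-almost all $x\in\mathbb{R}^d$.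
   Context: For $E\subseteq\mathbb{R}^d$ and $x\in\mathbb{R}^d$, $D_x(E)=\{|x-y|:y\in E\}$ is the pinned distance set. $\dim_{\mathrm H}$ is Hausdorff dimension and $\mathcal{L}^1$ is 1-dimensional Lebesgue measure on $\mathbb{R}$. For a finite Borel measure $\mu$ on $\mathbb{R}^d$, $\widehat\mu(z)=\int e^{-2\pi i z\cdot x}\,d\mu(x)$. The Fourier dimension of $\mu$ is $\dim_{\mathrm F}\mu=\sup\{s\ge 0:\sup_{z}|\widehat\mu(z)|^2|z|^s<\infty\}$. For $s\ge 0$ and $\theta\in(0,1]$ define $\mathcal{J}_{s,\theta}(\mu)=\left(\int_{\mathbb{R}^d}|\widehat\mu(z)|^{2/\theta}|z|^{s/\theta-d}\,dz\right)^{\theta}$; the Fourier spectrum of $\mu$ at $\theta$ is $\dim_{\mathrm F}^{\theta}\mu=\sup\{s\ge 0:\mathcal{J}_{s,\theta}(\mu)<\infty\}$ (with $\sup\emptyset=0$). *)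

theory Defs
  imports "HOL-Probability.Probability"
begin

text \<open>The topological support. On a separable metric space it is the least closed set of
  full measure, so a Borel measure is compactly supported iff this set is compact.\<close>

definition measure_support :: "'a::topological_space measure \<Rightarrow> 'a set" where
  "measure_support \<mu> = {x. \<forall>U. open U \<and> x \<in> U \<longrightarrow> emeasure \<mu> U > 0}"

definition pinned_distance_set :: "'a::real_normed_vector \<Rightarrow> 'a set \<Rightarrow> real set" where
  "pinned_distance_set x E = {norm (x - y) | y. y \<in> E}"

text \<open>\<open>diam_pow s U\<close> is the \<open>s\<close>-th power of the diameter of \<open>U\<close> with the usual conventions
  for \<open>s = 0\<close>: a nonempty set has value 1 (whereas \<open>0 powr 0 = 0\<close>) and the empty set has
  value 0. It is only meaningful for bounded \<open>U\<close>, since \<^const>\<open>diameter\<close> is unspecified on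
  unbounded sets; hence the covers below consist of bounded sets.\<close>

definition diam_pow :: "real \<Rightarrow> 'a::metric_space set \<Rightarrow> ennreal" where
  "diam_pow s U =
     (if U = {} then 0 else if s = 0 then 1 else ennreal (diameter U powr s))"

definition hausdorff_premeasure :: "real \<Rightarrow> real \<Rightarrow> 'a::metric_space set \<Rightarrow> ennreal" where
  "hausdorff_premeasure s \<delta> E =
     (INF U \<in> {U :: nat \<Rightarrow> 'a set.
                 E \<subseteq> (\<Union>i. U i) \<and> (\<forall>i. bounded (U i) \<and> diameter (U i) \<le> \<delta>)}.
        \<Sum>i. diam_pow s (U i))"

definition hausdorff_measure :: "real \<Rightarrow> 'a::metric_space set \<Rightarrow> ennreal" where
  "hausdorff_measure s E = (SUP \<delta> \<in> {0<..}. hausdorff_premeasure s \<delta> E)"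

definition hausdorff_dim :: "'a::metric_space set \<Rightarrow> ereal" where
  "hausdorff_dim E = Inf {ereal s | s. 0 \<le> s \<and> hausdorff_measure s E = 0}"

definition fourier_transform :: "'a::euclidean_space measure \<Rightarrow> 'a \<Rightarrow> complex" where
  "fourier_transform \<mu> z = (LINT x|\<mu>. exp (- (2 * of_real pi * \<i> * of_real (z \<bullet> x))))"

text \<open>Both dimensions below are extended real valued: they are infinite, for instance, for
  measures with a smooth density.\<close>

definition fourier_dim :: "'a::euclidean_space measure \<Rightarrow> ereal" where
  "fourier_dim \<mu> = Sup {ereal s | s. 0 \<le> s \<and>
     (SUP z. ennreal ((norm (fourier_transform \<mu> z))\<^sup>2 * norm z powr s)) < \<infinity>}"

definition fourier_energy_integral ::
    "real \<Rightarrow> real \<Rightarrow> 'a::euclidean_space measure \<Rightarrow> ennreal" where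
  "fourier_energy_integral s \<theta> \<mu> =
     (\<integral>\<^sup>+ z. ennreal (norm (fourier_transform \<mu> z) powr (2 / \<theta>)
                     * norm z powr (s / \<theta> - DIM('a))) \<partial>lborel)"

text \<open>The energy is the \<open>\<theta>\<close>-th power of the integral above, with \<open>\<infinity>\<close> to the power \<open>\<theta>\<close>
  being \<open>\<infinity>\<close> (for \<open>\<theta> > 0\<close>).\<close>

definition fourier_energy :: "real \<Rightarrow> real \<Rightarrow> 'a::euclidean_space measure \<Rightarrow> ennreal" where
  "fourier_energy s \<theta> \<mu> =
     (if fourier_energy_integral s \<theta> \<mu> = \<infinity> then \<infinity>
      else ennreal (enn2real (fourier_energy_integral s \<theta> \<mu>) powr \<theta>))"

text \<open>Inserting 0 implements the convention that the supremum of the empty set is 0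
  (in \<^typ>\<open>ereal\<close> it is \<open>-\<infinity>\<close>); it changes nothing otherwise, as all \<open>s\<close> are nonnegative.\<close>

definition fourier_spectrum :: "real \<Rightarrow> 'a::euclidean_space measure \<Rightarrow> ereal" where
  "fourier_spectrum \<theta> \<mu> =
     Sup (insert 0 {ereal s | s. 0 \<le> s \<and> fourier_energy s \<theta> \<mu> < \<infinity>})"

end

theory Submission
  imports Defs
begin

text \<open>
  Fix a pin \<open>x\<close>. Differences of \<^emph>\<open>squared\<close> distances are affine in the pin,
  \<open>|x - y|\<^sup>2 - |x - y'|\<^sup>2 = |y|\<^sup>2 - |y'|\<^sup>2 - 2 x \<bullet> (y - y')\<close>, so the average over
  \<open>x \<sim> \<mu>\<close> of \<open>exp (i t (|x - y|\<^sup>2 - |x - y'|\<^sup>2) / \<delta>)\<close> is, up to a factor of modulus one, the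
  Fourier transform of \<open>\<mu>\<close> at \<open>t (y - y') / (\<pi> \<delta>)\<close>. A Gaussian is the average of such
  exponentials over a standard normal frequency \<open>t\<close>. Hence the mass that \<open>\<mu> \<times> \<mu> \<times> \<mu>\<close> gives to
  the triples whose gap \<open>|x - y|\<^sup>2 - |x - y'|\<^sup>2\<close> is at most \<open>\<delta>\<close> in modulus is controlled by the
  average of \<open>|\<mu>^(t (y - y') / (\<pi> \<delta>))|\<close> over \<open>t\<close>, \<open>y\<close> and \<open>y'\<close>.

  Suppose that \<open>|\<mu>^(z)|\<close> is bounded by a multiple of \<open>|z|\<^sup>-\<^sup>a\<close>. For \<open>0 < u \<le> 1\<close> and \<open>u < a\<close>
  that average is at most a constant times \<open>\<delta>\<^sup>u\<close> times one plus the \<open>u\<close>-energy of \<open>\<mu>\<close>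
  (\<open>pinned_gaussian_average_le\<close>), and the energy is finite by the same Gaussian device
  applied to \<open>|y - y'|\<close> in place of the gap (\<open>gaussian_ball_average_le\<close>). Two coordinates are
  kept there because the case \<open>u = 1\<close> needs the mass of a ball to decay faster than its radius;
  this is where the dimension is at least 2. The result is \<open>mean_square_gap_gaussian_le\<close>.

  For \<open>v < u\<close> the bound makes the \<open>v\<close>-energy of the distribution of \<open>|x - y|\<close>, \<open>y \<sim> \<mu>\<close>,
  finite for almost all \<open>x\<close>, and a set carrying a measure of finite \<open>v\<close>-energy has Hausdorff
  dimension at least \<open>v\<close> (\<open>hausdorff_dim_ge_of_energy\<close>). For \<open>u = 1\<close>, Fatou's lemma yields for
  almost all \<open>x\<close> arbitrarily small scales \<open>\<delta>\<close> at which the close pairs have mass at most of order \<open>\<delta>\<close>,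
  which is impossible on a null set (\<open>emeasure_pos_of_close_pairs\<close>). As the decay exponent \<open>a\<close>
  may be any number below half the Fourier dimension, this proves the first part.

  The second part reduces to the first, because the Fourier dimension is at least the Fourier
  spectrum at \<open>\<theta>\<close> minus \<open>d \<theta>\<close> (\<open>fourier_spectrum_le_fourier_dim\<close>). As \<open>\<mu>\<close> has compact support,
  the \<open>k\<close>-th differences of \<open>\<mu>^\<close> with step \<open>h\<close> are \<open>O(|h|\<^sup>k)\<close>. A value \<open>m = |\<mu>^(z)|\<close> therefore
  forces comparably large values at distance about \<open>m\<^sup>1\<^sup>/\<^sup>k\<close> in every direction, and a single large
  value contributes about \<open>m\<close> to the power \<open>2/\<theta> + d/k\<close> to the energy integral. The loss \<open>d/k\<close>
  vanishes as \<open>k\<close> grows.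
\<close>

section \<open>Measures and their Fourier transforms\<close>

locale borel_prob_space = prob_space M for M :: "'a::euclidean_space measure" +
  assumes sets_borel [measurable_cong]: "sets M = sets borel"
begin

lemma space_M [simp]: "space M = UNIV"
  using sets_eq_imp_space_eq[OF sets_borel] by simp

lemma AE_measure_support: "AE y in M. y \<in> measure_support M"
proof -
  obtain B :: "'a set set" where B: "countable B" "topological_basis B"
    using ex_countable_basis by blast
  have o: "open b" if "b \<in> B" for b using B(2) that topological_basis_open by blast
  let ?Z = "\<Union>b\<in>{b\<in>B. emeasure M b = 0}. b"
  have "?Z \<in> null_sets M"
    using B(1) o by (intro null_sets_UN') (auto simp: null_sets_def sets_borel)
  moreover have "{y \<in> space M. y \<notin> measure_support M} \<subseteq> ?Z"
  proof
    fix y assume "y \<in> {y \<in> space M. y \<notin> measure_support M}"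
    then obtain U where U: "open U" "y \<in> U" "emeasure M U = 0"
      by (auto simp: measure_support_def)
    obtain b where b: "b \<in> B" "y \<in> b" "b \<subseteq> U"
      using topological_basisE[OF B(2) U(1,2)] by blast
    have "emeasure M b \<le> emeasure M U"
      using b U by (intro emeasure_mono) (auto simp: sets_borel)
    then show "y \<in> ?Z" using b U by auto
  qed
  ultimately show ?thesis by (rule AE_I')
qed

end

context borel_prob_space begin

lemma measurable_fourier_transform [measurable]: "fourier_transform M \<in> borel_measurable borel"
proof -
  have "(\<lambda>z::'a. LINT x|M. exp (- (2 * of_real pi * \<i> * of_real (z \<bullet> x)))) \<in> borel_measurable borel"
    by measurable
  then show ?thesis by (simp add: fourier_transform_def[abs_def])
qed

lemma norm_fourier_transform_le_1: "norm (fourier_transform M z) \<le> 1"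
proof -
  have "norm (fourier_transform M z) \<le> (LINT x|M. norm (exp (- (2 * of_real pi * \<i> * of_real (z \<bullet> x)))))"
    unfolding fourier_transform_def by (rule integral_norm_bound)
  also have "\<dots> = 1" using prob_space by simp
  finally show ?thesis .
qed

text \<open>Any nonnegative function that is a random superposition of characters has small \<open>\<mu>\<close>-average
  when its frequencies fall where the Fourier transform is small: exchange the two
  integrations. It is applied below to Gaussians only.\<close>

lemma oscillatory_average_le:
  fixes Q :: "'b measure" and c :: "'b \<Rightarrow> real" and \<Phi> :: "'b \<Rightarrow> 'a" and g :: "'a \<Rightarrow> real"
  assumes "prob_space Q" and [measurable]: "c \<in> borel_measurable Q" "\<Phi> \<in> borel_measurable Q"
    and g: "\<And>y. complex_of_real (g y) = (CLINT w|Q. iexp (c w - 2 * pi * (\<Phi> w \<bullet> y)))"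
    and g0: "\<And>y. 0 \<le> g y"
  shows "(\<integral>\<^sup>+y. ennreal (g y) \<partial>M) \<le> (\<integral>\<^sup>+w. ennreal (norm (fourier_transform M (\<Phi> w))) \<partial>Q)"
proof -
  interpret Q: prob_space Q by fact
  interpret MQ: pair_prob_space M Q ..
  let ?f = "\<lambda>y w. iexp (c w - 2 * pi * (\<Phi> w \<bullet> y))"
  have gm: "(\<lambda>y. complex_of_real (g y)) \<in> borel_measurable M"
    unfolding g by measurable
  have gm': "g \<in> borel_measurable M"
    using measurable_compose[OF gm borel_measurable_Re] by simp
  have gi: "integrable M g"
  proof (rule integrable_const_bound[where B=1])
    have "norm (complex_of_real (g y)) \<le> (LINT w|Q. norm (?f y w))" for y
      unfolding g by (rule integral_norm_bound)
    then show "AE y in M. norm (g y) \<le> 1" by (simp add: Q.prob_space)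
  qed (rule gm')
  have int: "integrable (M \<Otimes>\<^sub>M Q) (case_prod ?f)"
    by (rule MQ.integrable_const_bound[where B=1]) (auto simp: split_beta)
  have "complex_of_real (LINT y|M. g y) = (CLINT y|M. complex_of_real (g y))"
    by simp
  also have "\<dots> = (CLINT w|Q. CLINT y|M. ?f y w)"
    unfolding g by (rule MQ.Fubini_integral[symmetric, OF int])
  also have "norm \<dots> \<le> (LINT w|Q. norm (CLINT y|M. ?f y w))"
    by (rule integral_norm_bound)
  also have "\<dots> = (LINT w|Q. norm (fourier_transform M (\<Phi> w)))"
  proof (intro Bochner_Integration.integral_cong refl)
    fix w
    have "(CLINT y|M. ?f y w) = (CLINT y|M. iexp (c w) * exp (- (2 * of_real pi * \<i> * of_real (\<Phi> w \<bullet> y))))"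
      by (intro Bochner_Integration.integral_cong refl) (simp add: exp_add[symmetric] algebra_simps)
    also have "\<dots> = iexp (c w) * fourier_transform M (\<Phi> w)"
      by (simp add: fourier_transform_def)
    finally show "norm (CLINT y|M. ?f y w) = norm (fourier_transform M (\<Phi> w))"
      by (simp add: norm_mult)
  qed
  finally have le: "norm (complex_of_real (LINT y|M. g y)) \<le> (LINT w|Q. norm (fourier_transform M (\<Phi> w)))" .
  have "integrable Q (\<lambda>w. norm (fourier_transform M (\<Phi> w)))"
    using norm_fourier_transform_le_1 by (intro Q.integrable_const_bound[where B=1]) auto
  then have "(\<integral>\<^sup>+w. ennreal (norm (fourier_transform M (\<Phi> w))) \<partial>Q) = ennreal (LINT w|Q. norm (fourier_transform M (\<Phi> w)))"
    by (intro nn_integral_eq_integral) auto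
  moreover have "(\<integral>\<^sup>+y. ennreal (g y) \<partial>M) = ennreal (LINT y|M. g y)"
    using gi g0 by (intro nn_integral_eq_integral) auto
  ultimately show ?thesis using le by (simp add: ennreal_leI)
qed

end

section \<open>The standard normal distribution as a source of frequencies\<close>

abbreviation std_normal :: "real measure" where
  "std_normal \<equiv> std_normal_distribution"

lemma exp_eq_integral_iexp: "complex_of_real (exp (- (w\<^sup>2) / 2)) = (CLINT t|std_normal. iexp (t * w))"
  using fun_cong[OF char_std_normal_distribution, of w] by (simp add: char_def mult.commute)

lemma prob_space_std_normal: "prob_space std_normal"
  using real_dist_normal_dist by (simp add: real_distribution_def)

text \<open>The weight \<open>|t|\<^sup>u\<^sup>-\<^sup>1\<close> makes the integral homogeneous of degree \<open>u\<close> in \<open>b\<close>; the truncation at 1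
  gives convergence at 0, the decay of order \<open>a > u\<close> convergence at infinity.\<close>

lemma nn_integral_truncated_powr:
  fixes a b u :: real
  assumes "0 < u" "u < a" "0 < b"
  shows "(\<integral>\<^sup>+t. ennreal (min 1 ((b / \<bar>t\<bar>) powr a) * \<bar>t\<bar> powr (u - 1)) \<partial>lborel)
    \<le> ennreal (2 * (1 / u + 1 / (a - u)) * b powr u)"
proof -
  define h :: "real \<Rightarrow> ennreal" where "h t = ennreal (t powr (u - 1)) * indicator {0..b} t
     + ennreal (b powr a) * (ennreal (t powr (u - 1 - a)) * indicator {b..} t)" for t
  have hm [measurable]: "h \<in> borel_measurable borel"
    unfolding h_def by measurable
  have "((\<lambda>t. t powr (u - 1)) has_integral (b powr u / u)) {0..b}"
    using has_integral_powr_from_0[of "u - 1" b] assms by simp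
  then have 1: "(\<integral>\<^sup>+t. ennreal (t powr (u - 1)) * indicator {0..b} t \<partial>lborel) = ennreal (b powr u / u)"
    by (intro nn_integral_has_integral_lebesgue') auto
  have "((\<lambda>t. t powr (u - 1 - a)) has_integral (b powr (u - a) / (a - u))) {b..}"
    using has_integral_powr_to_inf[of "u - 1 - a" b] assms
    by (simp add: minus_divide_right del: minus_divide_left)
  then have 2: "(\<integral>\<^sup>+t. ennreal (t powr (u - 1 - a)) * indicator {b..} t \<partial>lborel) = ennreal (b powr (u - a) / (a - u))"
    by (intro nn_integral_has_integral_lebesgue') auto
  have "(\<integral>\<^sup>+t. h t \<partial>lborel) = ennreal (b powr u / u) + ennreal (b powr a) * ennreal (b powr (u - a) / (a - u))"
    unfolding h_def by (simp add: nn_integral_add nn_integral_cmult 1 2)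
  also have "\<dots> = ennreal (b powr u / u + b powr a * (b powr (u - a) / (a - u)))"
    using assms by (subst ennreal_mult[symmetric]) (auto simp: ennreal_plus simp del: times_divide_eq_right)
  also have "b powr a * (b powr (u - a) / (a - u)) = b powr u / (a - u)"
    using assms by (simp add: powr_add[symmetric])
  finally have h: "(\<integral>\<^sup>+t. h t \<partial>lborel) = ennreal (b powr u / u + b powr u / (a - u))" .
  have h': "(\<integral>\<^sup>+t. h (- t) \<partial>lborel) = (\<integral>\<^sup>+t. h t \<partial>lborel)"
    using nn_integral_real_affine[OF hm, of "-1" 0] by simp
  have pw: "ennreal (min 1 ((b / \<bar>t\<bar>) powr a) * \<bar>t\<bar> powr (u - 1)) \<le> h \<bar>t\<bar>" for t
  proof (cases "\<bar>t\<bar> \<le> b")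
    case True
    have "ennreal (min 1 ((b / \<bar>t\<bar>) powr a) * \<bar>t\<bar> powr (u - 1)) \<le> ennreal (\<bar>t\<bar> powr (u - 1))"
      by (intro ennreal_leI mult_left_le_one_le) auto
    also have "\<dots> \<le> h \<bar>t\<bar>"
      using True by (simp add: h_def)
    finally show ?thesis .
  next
    case False
    then have "min 1 ((b / \<bar>t\<bar>) powr a) * \<bar>t\<bar> powr (u - 1) \<le> (b / \<bar>t\<bar>) powr a * \<bar>t\<bar> powr (u - 1)"
      by (intro mult_right_mono) auto
    also have "\<dots> = b powr a * \<bar>t\<bar> powr (u - 1 - a)"
      using assms by (simp add: powr_divide powr_diff)
    finally have "ennreal (min 1 ((b / \<bar>t\<bar>) powr a) * \<bar>t\<bar> powr (u - 1)) \<le> ennreal (b powr a * \<bar>t\<bar> powr (u - 1 - a))"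
      by (rule ennreal_leI)
    then show ?thesis
      using False by (simp add: h_def ennreal_mult)
  qed
  have "h \<bar>t\<bar> \<le> h t + h (- t)" for t by (cases "t \<ge> 0") auto
  then have "(\<integral>\<^sup>+t. ennreal (min 1 ((b / \<bar>t\<bar>) powr a) * \<bar>t\<bar> powr (u - 1)) \<partial>lborel) \<le> (\<integral>\<^sup>+t. h t + h (- t) \<partial>lborel)"
    using pw by (intro nn_integral_mono) (meson order_trans)
  also have "\<dots> = (\<integral>\<^sup>+t. h t \<partial>lborel) + (\<integral>\<^sup>+t. h (- t) \<partial>lborel)"
    by (simp add: nn_integral_add)
  also have "\<dots> = ennreal (2 * (1 / u + 1 / (a - u)) * b powr u)"
    unfolding h' h using assms by (simp add: ennreal_plus[symmetric] del: ennreal_plus) (simp add: field_simps)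
  finally show ?thesis .
qed

text \<open>A crude comparison with powers, so that integrals against the normal law inherit the exact
  homogeneity of power weights. The whole range of exponents is needed: \<open>u = 1\<close> and \<open>u = 0\<close>
  control the density near 0 and near infinity.\<close>

lemma std_normal_density_le_powr:
  assumes "0 \<le> u" "u \<le> 1" "t \<noteq> 0"
  shows "std_normal_density t \<le> \<bar>t\<bar> powr (u - 1)"
proof -
  have s: "1 \<le> sqrt (2 * pi)" using pi_gt3 by simp
  have "std_normal_density t \<le> 1 * exp (- t\<^sup>2 / 2)"
    unfolding std_normal_density_def using s by (intro mult_right_mono) auto
  also have "1 * exp (- t\<^sup>2 / 2) \<le> \<bar>t\<bar> powr (u - 1)"
  proof (cases "\<bar>t\<bar> \<le> 1")
    case True
    have "1 \<le> \<bar>t\<bar> powr (u - 1)"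
      using powr_mono'[of "u - 1" 0 "\<bar>t\<bar>"] True assms by simp
    moreover have "1 * exp (- t\<^sup>2 / 2) \<le> 1" by simp
    ultimately show ?thesis by (rule order_trans[rotated])
  next
    case False
    have "\<bar>t\<bar> \<le> 1 + t\<^sup>2 / 2"
      using sum_power2_ge_zero[of "\<bar>t\<bar> - 1" 0] by (simp add: power2_diff)
    also have "\<dots> \<le> exp (t\<^sup>2 / 2)" by (rule exp_ge_add_one_self)
    finally have "exp (- t\<^sup>2 / 2) \<le> \<bar>t\<bar> powr (- 1)"
      using assms by (simp add: exp_minus powr_minus powr_one le_imp_inverse_le)
    also have "\<dots> \<le> \<bar>t\<bar> powr (u - 1)" using assms False by (intro powr_mono) auto
    finally show ?thesis by simp
  qed
  finally show ?thesis .
qed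

lemma nn_integral_std_normal_le:
  assumes [measurable]: "f \<in> borel_measurable borel" and w: "\<And>t. 0 \<le> w t"
    and "\<And>t. t \<noteq> 0 \<Longrightarrow> std_normal_density t \<le> w t"
  shows "(\<integral>\<^sup>+t. f t \<partial>std_normal) \<le> (\<integral>\<^sup>+t. ennreal (w t) * f t \<partial>lborel)"
proof -
  have "(\<integral>\<^sup>+t. f t \<partial>std_normal) = (\<integral>\<^sup>+t. ennreal (std_normal_density t) * f t \<partial>lborel)"
    by (subst nn_integral_density) auto
  also have "\<dots> \<le> (\<integral>\<^sup>+t. ennreal (w t) * f t \<partial>lborel)"
    using assms(3) AE_lborel_singleton[of "0::real"]
    by (intro nn_integral_mono_AE) (auto elim!: eventually_mono intro!: mult_right_mono ennreal_leI)
  finally show ?thesis .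
qed

lemma nn_integral_std_normal_truncated_powr:
  fixes a b u :: real
  assumes "0 < u" "u \<le> 1" "u < a" "0 < b"
  shows "(\<integral>\<^sup>+t. ennreal (min 1 ((b / \<bar>t\<bar>) powr a)) \<partial>std_normal)
    \<le> ennreal (2 * (1 / u + 1 / (a - u)) * b powr u)"
proof -
  have "(\<integral>\<^sup>+t. ennreal (min 1 ((b / \<bar>t\<bar>) powr a)) \<partial>std_normal)
     \<le> (\<integral>\<^sup>+t. ennreal (\<bar>t\<bar> powr (u - 1)) * ennreal (min 1 ((b / \<bar>t\<bar>) powr a)) \<partial>lborel)"
    using assms by (intro nn_integral_std_normal_le std_normal_density_le_powr) auto
  also have "\<dots> = (\<integral>\<^sup>+t. ennreal (min 1 ((b / \<bar>t\<bar>) powr a) * \<bar>t\<bar> powr (u - 1)) \<partial>lborel)"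
    by (intro nn_integral_cong) (simp add: ennreal_mult mult.commute)
  also have "\<dots> \<le> ennreal (2 * (1 / u + 1 / (a - u)) * b powr u)"
    using assms by (intro nn_integral_truncated_powr) auto
  finally show ?thesis .
qed

lemma nn_integral_std_normal_powr_neg:
  fixes q :: real
  assumes "0 < q" "q < 1"
  shows "(\<integral>\<^sup>+t. ennreal (\<bar>t\<bar> powr (- q)) \<partial>std_normal) < \<infinity>"
proof -
  define w where "w t = min 1 ((1 / \<bar>t\<bar>) powr 1)" for t :: real
  have w: "std_normal_density t \<le> w t" if "t \<noteq> 0" for t
    using std_normal_density_le_powr[of 1 t] std_normal_density_le_powr[of 0 t] that
    by (simp add: w_def powr_minus inverse_eq_divide)
  have "(\<integral>\<^sup>+t. ennreal (\<bar>t\<bar> powr (- q)) \<partial>std_normal)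
     \<le> (\<integral>\<^sup>+t. ennreal (w t) * ennreal (\<bar>t\<bar> powr (- q)) \<partial>lborel)"
    by (intro nn_integral_std_normal_le w) (auto simp: w_def)
  also have "\<dots> = (\<integral>\<^sup>+t. ennreal (min 1 ((1 / \<bar>t\<bar>) powr 1) * \<bar>t\<bar> powr ((1 - q) - 1)) \<partial>lborel)"
    by (intro nn_integral_cong) (simp add: w_def ennreal_mult)
  also have "\<dots> \<le> ennreal (2 * (1 / (1 - q) + 1 / (1 - (1 - q))) * 1 powr (1 - q))"
    using assms by (intro nn_integral_truncated_powr) auto
  also have "\<dots> < \<infinity>" by simp
  finally show ?thesis .
qed

lemma AE_std_normal_neq_0: "AE t in std_normal. t \<noteq> 0"
  using AE_lborel_singleton[of "0::real"] by (subst AE_density) (auto elim: eventually_mono)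

section \<open>A dyadic Gaussian substitute for the Riesz kernel\<close>

text \<open>Up to constants this is \<open>|r|\<^sup>-\<^sup>u\<close> for \<open>|r| \<le> 1\<close>, decomposed into Gaussians of width \<open>2\<^sup>-\<^sup>n\<close>. It
  replaces the Riesz kernel because its integrals reduce to Gaussian averages, and because it
  takes the value \<open>\<infinity>\<close> at 0, so that finite energy rules out atoms (whereas \<open>0 powr (- u) = 0\<close>).\<close>

definition gauss_riesz :: "real \<Rightarrow> real \<Rightarrow> ennreal" where
  "gauss_riesz u r = (\<Sum>n. ennreal (2 powr (u * real n) * exp (- ((2 ^ n * r)\<^sup>2) / 2)))"

lemma measurable_gauss_riesz [measurable]: "gauss_riesz u \<in> borel_measurable borel"
  unfolding gauss_riesz_def[abs_def] by measurable

lemma term_le_suminf: "f n \<le> (\<Sum>n. f n)" for f :: "nat \<Rightarrow> ennreal"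
  using sum_le_suminf[of f "{n}"] by (simp add: summableI)

lemma powr_le_gauss_riesz:
  assumes "0 \<le> u" "0 < D" "D \<le> 1" "\<bar>r\<bar> \<le> D"
  shows "ennreal (D powr (- u)) \<le> ennreal (2 powr u * exp (1/2)) * gauss_riesz u r"
proof -
  \<comment> \<open>The summand whose width \<open>2\<^sup>-\<^sup>n\<close> is comparable to \<open>D\<close>: \<open>2\<^sup>-\<^sup>n\<^sup>-\<^sup>1 < D \<le> 2\<^sup>-\<^sup>n\<close>.\<close>
  define n where "n = nat \<lfloor>log 2 (1 / D)\<rfloor>"
  have "0 \<le> log 2 (1 / D)" using assms by simp
  then have n: "real n \<le> log 2 (1 / D)" "log 2 (1 / D) < real n + 1"
    unfolding n_def by linarith+
  have "2 powr real n \<le> 1 / D"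
    using n(1) assms by (simp add: le_log_iff)
  then have n1: "2 ^ n * D \<le> 1" using assms by (simp add: powr_realpow field_simps)
  have "1 / D \<le> 2 powr (real n + 1)"
    using n(2) assms by (simp add: log_less_iff less_imp_le)
  then have "(1 / D) powr u \<le> (2 powr (real n + 1)) powr u"
    using assms by (intro powr_mono2) auto
  also have "\<dots> = 2 powr u * 2 powr (u * real n)"
    by (simp add: powr_powr powr_add[symmetric] algebra_simps)
  finally have 1: "D powr (- u) \<le> 2 powr u * 2 powr (u * real n)"
    using assms by (simp add: powr_divide powr_minus inverse_eq_divide)
  have "\<bar>2 ^ n * r\<bar> \<le> 1" using order_trans[OF mult_left_mono[OF assms(4), of "2 ^ n"] n1] by (simp add: abs_mult)
  then have "(2 ^ n * r)\<^sup>2 \<le> 1" by (simp add: abs_square_le_1)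
  then have "1 \<le> exp (1/2) * exp (- ((2 ^ n * r)\<^sup>2) / 2)" by (simp add: exp_add[symmetric])
  then have "2 powr u * 2 powr (u * real n) * 1 \<le> 2 powr u * 2 powr (u * real n) * (exp (1/2) * exp (- ((2 ^ n * r)\<^sup>2) / 2))"
    by (intro mult_left_mono) auto
  then have "D powr (- u) \<le> 2 powr u * 2 powr (u * real n) * (exp (1/2) * exp (- ((2 ^ n * r)\<^sup>2) / 2))"
    unfolding mult_1_right by (rule order_trans[OF 1])
  then have "D powr (- u) \<le> (2 powr u * exp (1/2)) * (2 powr (u * real n) * exp (- ((2 ^ n * r)\<^sup>2) / 2))"
    by (simp only: mult_ac)
  then have "ennreal (D powr (- u)) \<le> ennreal (2 powr u * exp (1/2)) * ennreal (2 powr (u * real n) * exp (- ((2 ^ n * r)\<^sup>2) / 2))"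
    by (subst ennreal_mult[symmetric]) (auto intro: ennreal_leI)
  also have "\<dots> \<le> ennreal (2 powr u * exp (1/2)) * gauss_riesz u r"
    unfolding gauss_riesz_def by (rule mult_left_mono[OF term_le_suminf]) simp
  finally show ?thesis .
qed

lemma gauss_riesz_0: 
  assumes "0 < u" shows "gauss_riesz u 0 = \<infinity>"
proof (rule ccontr)
  assume "gauss_riesz u 0 \<noteq> \<infinity>"
  then obtain g where g: "gauss_riesz u 0 = ennreal g" "0 \<le> g"
    by (cases "gauss_riesz u 0") auto
  define c where "c = 2 powr u * exp (1/2) * g"
  have c0: "c \<ge> 0" using g by (simp add: c_def)
  have le: "D powr (- u) \<le> c" if "0 < D" "D \<le> 1" for D :: real
    using powr_le_gauss_riesz[of u D 0] assms that g
    by (simp add: c_def ennreal_mult[symmetric] mult.assoc)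
  have "(c + 1) powr (-1/u) \<le> 1"
    using c0 assms powr_mono[of "-1/u" 0 "c + 1"] by simp
  then have "((c + 1) powr (-1/u)) powr (- u) \<le> c"
    using c0 by (intro le) auto
  then show False using assms c0 by (simp add: powr_powr)
qed

text \<open>Summing the Gaussian averages over the dyadic scales gives a geometric series of ratio
  \<open>2\<^sup>u\<^sup>-\<^sup>p\<close>: a gain of order \<open>p\<close> at each scale pays for an energy of any order below \<open>p\<close>.\<close>

lemma nn_integral_gauss_riesz_le:
  assumes [measurable]: "f \<in> borel_measurable P" and "u < p" "0 \<le> K"
    and le: "\<And>\<delta>::real. 0 < \<delta> \<Longrightarrow> (\<integral>\<^sup>+w. ennreal (exp (- ((f w / \<delta>)\<^sup>2) / 2)) \<partial>P) \<le> ennreal (K * \<delta> powr p)"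
  shows "(\<integral>\<^sup>+w. gauss_riesz u (f w) \<partial>P) \<le> ennreal (K / (1 - 2 powr (u - p)))"
proof -
  have r: "2 powr (u - p) < 1" using powr_less_mono[of "u - p" 0 2] assms(2) by simp
  have "(\<integral>\<^sup>+w. gauss_riesz u (f w) \<partial>P)
     = (\<Sum>n. \<integral>\<^sup>+w. ennreal (2 powr (u * real n)) * ennreal (exp (- ((2 ^ n * f w)\<^sup>2) / 2)) \<partial>P)"
    unfolding gauss_riesz_def by (subst nn_integral_suminf) (auto simp: ennreal_mult)
  also have "\<dots> \<le> (\<Sum>n. ennreal (K * (2 powr (u - p)) ^ n))"
  proof (rule suminf_le)
    fix n
    have "(\<integral>\<^sup>+w. ennreal (2 powr (u * real n)) * ennreal (exp (- ((2 ^ n * f w)\<^sup>2) / 2)) \<partial>P)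
       = ennreal (2 powr (u * real n)) * (\<integral>\<^sup>+w. ennreal (exp (- ((f w / (1 / 2 ^ n))\<^sup>2) / 2)) \<partial>P)"
      by (subst nn_integral_cmult) (auto simp: mult.commute)
    also have "\<dots> \<le> ennreal (2 powr (u * real n)) * ennreal (K * (1 / 2 ^ n) powr p)"
      by (intro mult_left_mono le) auto
    also have "\<dots> = ennreal (K * (2 powr (u * real n) * (1 / 2 ^ n) powr p))"
      using assms(3) by (simp add: ennreal_mult[symmetric] mult_ac)
    also have "(1 / 2 ^ n) powr p = 2 powr (- p * real n)"
      by (simp add: powr_divide powr_realpow[symmetric] powr_powr powr_minus field_simps del: powr_realpow)
    also have "2 powr (u * real n) * 2 powr (- p * real n) = (2 powr (u - p)) ^ n"
      by (simp add: powr_add[symmetric] powr_realpow[symmetric] powr_powr algebra_simps del: powr_realpow)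
    finally show "(\<integral>\<^sup>+w. ennreal (2 powr (u * real n)) * ennreal (exp (- ((2 ^ n * f w)\<^sup>2) / 2)) \<partial>P)
       \<le> ennreal (K * (2 powr (u - p)) ^ n)" .
  qed auto
  also have "\<dots> = ennreal (\<Sum>n. K * (2 powr (u - p)) ^ n)"
    using r assms(3) by (intro suminf_ennreal2) (auto intro!: summable_mult summable_geometric)
  also have "(\<Sum>n. K * (2 powr (u - p)) ^ n) = K / (1 - 2 powr (u - p))"
    using r by (subst suminf_mult) (auto simp: suminf_geometric intro!: summable_geometric)
  finally show ?thesis .
qed
lemma powr_neg_le_gauss_riesz:
  assumes "0 < u" "0 < r"
  shows "ennreal (r powr (- u)) \<le> ennreal (2 powr u * exp (1/2)) * (1 + gauss_riesz u r)"
proof (cases "r \<le> 1")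
  case True
  then have "ennreal (r powr (- u)) \<le> ennreal (2 powr u * exp (1/2)) * gauss_riesz u r"
    using assms by (intro powr_le_gauss_riesz) auto
  also have "\<dots> \<le> ennreal (2 powr u * exp (1/2)) * (1 + gauss_riesz u r)"
    by (intro mult_left_mono) auto
  finally show ?thesis .
next
  case False
  have "r powr (- u) \<le> 1" using False assms powr_mono[of "- u" 0 r] by simp
  moreover have "1 * 1 \<le> 2 powr u * exp (1/2)" 
    using assms powr_mono[of 0 u 2] by (intro mult_mono) auto
  ultimately have "ennreal (r powr (- u)) \<le> ennreal (2 powr u * exp (1/2)) * 1"
    by (simp add: ennreal_leI)
  also have "\<dots> \<le> ennreal (2 powr u * exp (1/2)) * (1 + gauss_riesz u r)"
    by (intro mult_left_mono) auto
  finally show ?thesis .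
qed

section \<open>Gaussian averages controlled by Fourier decay\<close>

context borel_prob_space begin

text \<open>Lowering the exponent is harmless at infinity, and near the origin the Fourier transform is
  bounded by 1.\<close>

lemma fourier_decay_mono:
  assumes "\<And>z. z \<noteq> 0 \<Longrightarrow> norm (fourier_transform M z) \<le> C * norm z powr (- a)" "p \<le> a" "0 \<le> p" "z \<noteq> 0"
  shows "norm (fourier_transform M z) \<le> max C 1 * norm z powr (- p)"
proof (cases "norm z \<le> 1")
  case True
  have "1 \<le> norm z powr (- p)" using powr_mono'[of "- p" 0 "norm z"] True assms by simp
  then have "1 * 1 \<le> max C 1 * norm z powr (- p)" by (intro mult_mono) auto
  then have "1 \<le> max C 1 * norm z powr (- p)" by simp
  with norm_fourier_transform_le_1 show ?thesis by (rule order_trans)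
next
  case False
  have "norm (fourier_transform M z) \<le> C * norm z powr (- a)" by (rule assms) fact
  also have "\<dots> \<le> max C 1 * norm z powr (- p)"
    using assms False by (intro mult_mono powr_mono) auto
  finally show ?thesis .
qed

text \<open>A Gaussian in two of the coordinates dominates the full one and is the characteristic
  function of a planar normal vector \<open>(s, t)\<close>. Since \<open>|(s, t)|\<^sup>2 \<ge> |s| |t|\<close>, the negative moment
  of order \<open>p\<close> of that vector is at most the square of the one-dimensional moment of order
  \<open>p/2\<close>, which is finite because \<open>p < 2\<close>.\<close>

lemma gaussian_ball_average_le:
  assumes "DIM('a) \<ge> 2"
    and decay: "\<And>z. z \<noteq> 0 \<Longrightarrow> norm (fourier_transform M z) \<le> C * norm z powr (- p)"
    and "0 < p" "p < 2" "0 \<le> C"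
  obtains K where "0 \<le> K" and
    "\<And>\<delta> y'. 0 < \<delta> \<Longrightarrow> (\<integral>\<^sup>+y. ennreal (exp (- ((norm (y - y') / \<delta>)\<^sup>2) / 2)) \<partial>M) \<le> ennreal (K * \<delta> powr p)"
proof -
  interpret N: prob_space std_normal by (rule prob_space_std_normal)
  interpret NN: pair_prob_space std_normal std_normal ..
  obtain T :: "'a set" where T: "T \<subseteq> Basis" "card T = 2"
    using obtain_subset_with_card_n[OF assms(1)] by metis
  then obtain e1 e2 :: 'a where e: "T = {e1, e2}" "e1 \<noteq> e2" by (auto simp: card_2_iff)
  have e': "e1 \<in> Basis" "e2 \<in> Basis" "e1 \<bullet> e1 = 1" "e2 \<bullet> e2 = 1" "e1 \<bullet> e2 = 0" "e2 \<bullet> e1 = 0"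
    using T e by (auto simp: inner_Basis)
  define E where "E = (\<integral>\<^sup>+t. ennreal (\<bar>t\<bar> powr (- (p/2))) \<partial>std_normal)"
  have "E < \<infinity>" unfolding E_def using assms by (intro nn_integral_std_normal_powr_neg) auto
  then obtain E' where E': "E = ennreal E'" "0 \<le> E'" by (cases E) auto
  show ?thesis
  proof (rule that[of "C * (2 * pi) powr p * E'\<^sup>2"])
    show "0 \<le> C * (2 * pi) powr p * E'\<^sup>2" using assms by simp
    fix \<delta> :: real and y' :: 'a assume \<delta>: "0 < \<delta>"
    \<comment> \<open>The phase \<open>s \<alpha> y + t \<beta> y\<close> is \<open>c (s, t) - 2 \<pi> (\<Phi> (s, t) \<bullet> y)\<close>: \<open>\<Phi>\<close> is the frequency, \<open>c\<close> comes from the centre \<open>y'\<close>.\<close>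
    define \<alpha> where "\<alpha> y = ((y - y') \<bullet> e1) / \<delta>" for y
    define \<beta> where "\<beta> y = ((y - y') \<bullet> e2) / \<delta>" for y
    define \<Phi> :: "real \<times> real \<Rightarrow> 'a" where
      "\<Phi> w = - (1 / (2 * pi * \<delta>)) *\<^sub>R (fst w *\<^sub>R e1 + snd w *\<^sub>R e2)" for w
    define c :: "real \<times> real \<Rightarrow> real" where
      "c w = - (fst w * (y' \<bullet> e1) + snd w * (y' \<bullet> e2)) / \<delta>" for w
    have [measurable]: "\<Phi> \<in> borel_measurable (borel \<Otimes>\<^sub>M borel)"
      unfolding \<Phi>_def by measurable
    have m: "\<Phi> \<in> borel_measurable (std_normal \<Otimes>\<^sub>M std_normal)"
      "c \<in> borel_measurable (std_normal \<Otimes>\<^sub>M std_normal)"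
      unfolding \<Phi>_def c_def by measurable
    have "\<Phi> w \<bullet> y = - (1 / (2 * pi * \<delta>)) * (fst w * (y \<bullet> e1) + snd w * (y \<bullet> e2))" for w y
      unfolding \<Phi>_def inner_scaleR_left inner_add_left by (simp add: inner_commute)
    note \<Phi>_inner = this
    have phase: "c w - 2 * pi * (\<Phi> w \<bullet> y) = fst w * \<alpha> y + snd w * \<beta> y" for w y
      unfolding \<Phi>_inner c_def \<alpha>_def \<beta>_def using \<delta>
      by (simp add: inner_diff_left field_simps)
    have "(norm v)\<^sup>2 \<ge> (v \<bullet> e1)\<^sup>2 + (v \<bullet> e2)\<^sup>2" for v :: 'a
    proof -
      have "(v \<bullet> e1)\<^sup>2 + (v \<bullet> e2)\<^sup>2 = (\<Sum>b\<in>T. (v \<bullet> b)\<^sup>2)" using e by simp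
      also have "\<dots> \<le> (\<Sum>b\<in>Basis. (v \<bullet> b)\<^sup>2)" using T by (intro sum_mono2) auto
      also have "\<dots> = (norm v)\<^sup>2"
        unfolding power2_norm_eq_inner by (subst euclidean_inner) (simp add: power2_eq_square)
      finally show ?thesis .
    qed
    then have "(\<alpha> y)\<^sup>2 + (\<beta> y)\<^sup>2 \<le> (norm (y - y') / \<delta>)\<^sup>2" for y
      using \<delta> unfolding \<alpha>_def \<beta>_def by (simp add: power_divide add_divide_distrib[symmetric] divide_right_mono)
    then have le: "exp (- ((norm (y - y') / \<delta>)\<^sup>2) / 2) \<le> exp (- ((\<alpha> y)\<^sup>2) / 2) * exp (- ((\<beta> y)\<^sup>2) / 2)" for y
      unfolding exp_add[symmetric] exp_le_cancel_iff by (simp add: field_simps)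
    have "(\<integral>\<^sup>+y. ennreal (exp (- ((norm (y - y') / \<delta>)\<^sup>2) / 2)) \<partial>M)
       \<le> (\<integral>\<^sup>+y. ennreal (exp (- ((\<alpha> y)\<^sup>2) / 2) * exp (- ((\<beta> y)\<^sup>2) / 2)) \<partial>M)"
      using le by (intro nn_integral_mono ennreal_leI)
    also have "\<dots> \<le> (\<integral>\<^sup>+w. ennreal (norm (fourier_transform M (\<Phi> w))) \<partial>(std_normal \<Otimes>\<^sub>M std_normal))"
    proof (rule oscillatory_average_le[OF NN.prob_space_axioms m(2,1)])
      fix y
      have i: "integrable (std_normal \<Otimes>\<^sub>M std_normal) (\<lambda>w. iexp (fst w * \<alpha> y + snd w * \<beta> y))"
        by (rule NN.integrable_const_bound[where B=1]) auto
      have "complex_of_real (exp (- ((\<alpha> y)\<^sup>2) / 2) * exp (- ((\<beta> y)\<^sup>2) / 2))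
          = (CLINT s|std_normal. iexp (s * \<alpha> y)) * (CLINT t|std_normal. iexp (t * \<beta> y))"
        by (simp only: of_real_mult exp_eq_integral_iexp)
      also have "\<dots> = (CLINT s|std_normal. CLINT t|std_normal. iexp (s * \<alpha> y + t * \<beta> y))"
        by (simp add: exp_add distrib_left)
      also have "\<dots> = (CLINT w|(std_normal \<Otimes>\<^sub>M std_normal). iexp (fst w * \<alpha> y + snd w * \<beta> y))"
        using NN.integral_fst'[OF i] by simp
      finally show "complex_of_real (exp (- ((\<alpha> y)\<^sup>2) / 2) * exp (- ((\<beta> y)\<^sup>2) / 2))
          = (CLINT w|(std_normal \<Otimes>\<^sub>M std_normal). iexp (c w - 2 * pi * (\<Phi> w \<bullet> y)))"
        by (simp only: phase)
    qed auto
    also have "\<dots> = (\<integral>\<^sup>+s. \<integral>\<^sup>+t. ennreal (norm (fourier_transform M (\<Phi> (s, t)))) \<partial>std_normal \<partial>std_normal)"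
      by (intro N.nn_integral_fst[symmetric]) measurable
    also have "\<dots> \<le> (\<integral>\<^sup>+s. \<integral>\<^sup>+t. ennreal (C * (2 * pi * \<delta>) powr p) *
         (ennreal (\<bar>s\<bar> powr (- (p/2))) * ennreal (\<bar>t\<bar> powr (- (p/2)))) \<partial>std_normal \<partial>std_normal)"
    proof (intro nn_integral_mono_AE eventually_mono[OF AE_std_normal_neq_0])
      fix s t :: real assume st: "s \<noteq> 0" "t \<noteq> 0"
      have "(norm (s *\<^sub>R e1 + t *\<^sub>R e2))\<^sup>2 = s\<^sup>2 + t\<^sup>2"
        using e' unfolding power2_norm_eq_inner by (simp add: inner_add_left inner_add_right power2_eq_square)
      moreover have "\<bar>s\<bar> * \<bar>t\<bar> \<le> s\<^sup>2 + t\<^sup>2"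
      proof -
        have "0 \<le> (\<bar>s\<bar> - \<bar>t\<bar>)\<^sup>2" "0 \<le> \<bar>s\<bar> * \<bar>t\<bar>" by auto
        moreover have "(\<bar>s\<bar> - \<bar>t\<bar>)\<^sup>2 = s\<^sup>2 + t\<^sup>2 - 2 * (\<bar>s\<bar> * \<bar>t\<bar>)" by (simp add: power2_diff)
        ultimately show ?thesis by linarith
      qed
      ultimately have "sqrt (\<bar>s\<bar> * \<bar>t\<bar>) \<le> norm (s *\<^sub>R e1 + t *\<^sub>R e2)"
        by (intro real_le_lsqrt) auto
      then have n: "sqrt (\<bar>s\<bar> * \<bar>t\<bar>) / (2 * pi * \<delta>) \<le> norm (\<Phi> (s, t))"
        using \<delta> by (simp add: \<Phi>_def abs_mult divide_right_mono)
      have pos: "0 < sqrt (\<bar>s\<bar> * \<bar>t\<bar>) / (2 * pi * \<delta>)" using st \<delta> by simp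
      with n have "\<Phi> (s, t) \<noteq> 0" by auto
      then have "norm (fourier_transform M (\<Phi> (s, t))) \<le> C * norm (\<Phi> (s, t)) powr (- p)"
        by (rule decay)
      also have "\<dots> \<le> C * (sqrt (\<bar>s\<bar> * \<bar>t\<bar>) / (2 * pi * \<delta>)) powr (- p)"
        using assms n pos by (intro mult_left_mono powr_mono2') auto
      also have "(sqrt (\<bar>s\<bar> * \<bar>t\<bar>) / (2 * pi * \<delta>)) powr (- p)
          = (2 * pi * \<delta>) powr p * (\<bar>s\<bar> powr (- (p/2)) * \<bar>t\<bar> powr (- (p/2)))"
        using st \<delta> by (simp add: powr_half_sqrt[symmetric] powr_divide powr_powr powr_mult powr_minus field_simps)
      finally have "norm (fourier_transform M (\<Phi> (s, t))) \<le> (C * (2 * pi * \<delta>) powr p) * (\<bar>s\<bar> powr (- (p/2)) * \<bar>t\<bar> powr (- (p/2)))"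
        by (simp add: mult.assoc)
      then show "ennreal (norm (fourier_transform M (\<Phi> (s, t)))) \<le> ennreal (C * (2 * pi * \<delta>) powr p) *
         (ennreal (\<bar>s\<bar> powr (- (p/2))) * ennreal (\<bar>t\<bar> powr (- (p/2))))"
        using assms by (simp add: ennreal_mult[symmetric] ennreal_leI)
    qed
    also have "\<dots> = ennreal (C * (2 * pi * \<delta>) powr p) * (E * E)"
      by (simp add: nn_integral_cmult nn_integral_multc E_def)
    also have "\<dots> = ennreal (C * (2 * pi) powr p * E'\<^sup>2 * \<delta> powr p)"
      using assms \<delta> E' by (simp add: ennreal_mult[symmetric] powr_mult power2_eq_square mult_ac)
    finally show "(\<integral>\<^sup>+y. ennreal (exp (- ((norm (y - y') / \<delta>)\<^sup>2) / 2)) \<partial>M)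
       \<le> ennreal (C * (2 * pi) powr p * E'\<^sup>2 * \<delta> powr p)" .
  qed
qed

end

section \<open>Gaps between squared pinned distances\<close>

text \<open>The two points whose squared distances to the pin \<open>x\<close> are compared form a pair, so that this is
  a random variable on the product of the measure with itself.\<close>

definition square_gap :: "'a::real_normed_vector \<Rightarrow> 'a \<times> 'a \<Rightarrow> real" where
  "square_gap x p = (norm (x - fst p))\<^sup>2 - (norm (x - snd p))\<^sup>2"

text \<open>Distances rather than squared distances are wanted in the end; the factor \<open>|x - y| + |x - y'|\<close>
  is bounded. The summand 1 keeps the constant away from 0 when \<open>S\<close> is a point.\<close>

lemma square_gap_le:
  assumes "bounded S" "x \<in> S" "y \<in> S" "y' \<in> S"
  shows "\<bar>square_gap x (y, y')\<bar> \<le> 2 * (diameter S + 1) * \<bar>norm (x - y) - norm (x - y')\<bar>"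
proof -
  have "norm (x - y) \<le> diameter S" "norm (x - y') \<le> diameter S"
    using diameter_bounded_bound[OF assms(1,2)] assms(3,4) by (auto simp: dist_norm)
  then have "\<bar>norm (x - y) + norm (x - y')\<bar> \<le> 2 * (diameter S + 1)" by simp
  then have "\<bar>norm (x - y) + norm (x - y')\<bar> * \<bar>norm (x - y) - norm (x - y')\<bar>
    \<le> 2 * (diameter S + 1) * \<bar>norm (x - y) - norm (x - y')\<bar>"
    by (rule mult_right_mono) simp
  moreover have "square_gap x (y, y') = (norm (x - y) + norm (x - y')) * (norm (x - y) - norm (x - y'))"
    by (simp add: square_gap_def power2_eq_square algebra_simps)
  ultimately show ?thesis by (simp only: abs_mult)
qed

context borel_prob_space begin

text \<open>Here the pin is the variable of integration. The gap is affine in it with slope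
  \<open>-2 (y - y')\<close>, so a standard normal \<open>t\<close> probes the Fourier transform along the line through
  \<open>y - y'\<close>, where it is at most \<open>min 1 ((b / |t|)\<^sup>a)\<close> with \<open>b\<close> proportional to \<open>\<delta> / |y - y'|\<close>.\<close>

lemma pinned_gaussian_average_le:
  assumes decay: "\<And>z. z \<noteq> 0 \<Longrightarrow> norm (fourier_transform M z) \<le> C * norm z powr (- a)"
    and "0 < u" "u \<le> 1" "u < a" "0 < C"
  obtains K where "0 < K" and
    "\<And>\<delta> y y'. 0 < \<delta> \<Longrightarrow>
      (\<integral>\<^sup>+x. ennreal (exp (- ((((norm (x - y))\<^sup>2 - (norm (x - y'))\<^sup>2) / \<delta>)\<^sup>2) / 2)) \<partial>M)
        \<le> ennreal (K * \<delta> powr u) * (1 + gauss_riesz u (norm (y - y')))"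
proof -
  \<comment> \<open>Chosen so that \<open>C |\<Phi> t|\<^sup>-\<^sup>a = (b / |t|)\<^sup>a\<close> for \<open>b = B \<delta> / |y - y'|\<close>.\<close>
  define B where "B = pi * C powr (1 / a)"
  have B: "0 < B" using assms by (simp add: B_def)
  define K where "K = 2 * (1 / u + 1 / (a - u)) * B powr u * (2 powr u * exp (1/2))"
  have K: "0 < K" unfolding K_def using assms B by (intro mult_pos_pos add_pos_pos) auto
  show ?thesis
  proof (rule that[OF K])
    fix \<delta> :: real and y y' :: 'a assume \<delta>: "0 < \<delta>"
    show "(\<integral>\<^sup>+x. ennreal (exp (- ((((norm (x - y))\<^sup>2 - (norm (x - y'))\<^sup>2) / \<delta>)\<^sup>2) / 2)) \<partial>M)
        \<le> ennreal (K * \<delta> powr u) * (1 + gauss_riesz u (norm (y - y')))" (is "?L \<le> _")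
    proof (cases "y = y'")
      case True
      have "ennreal (K * \<delta> powr u) \<noteq> 0" 
      proof -
        have "0 < K * \<delta> powr u" using K \<delta> by (intro mult_pos_pos) auto
        then show ?thesis by (metis ennreal_eq_0_iff not_le)
      qed
      then show ?thesis using True assms by (simp add: gauss_riesz_0 ennreal_mult_top)
    next
      case False
      define v where "v = y - y'"
      have v: "v \<noteq> 0" using False by (simp add: v_def)
      define \<Phi> where "\<Phi> t = (t / (pi * \<delta>)) *\<^sub>R v" for t
      define c where "c t = t * ((norm y)\<^sup>2 - (norm y')\<^sup>2) / \<delta>" for t
      define b where "b = B * \<delta> / norm v"
      have b: "0 < b" using B \<delta> v by (simp add: b_def)
      have phase: "c t - 2 * pi * (\<Phi> t \<bullet> x) = t * (((norm (x - y))\<^sup>2 - (norm (x - y'))\<^sup>2) / \<delta>)" for t x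
      proof -
        have "(norm (x - y))\<^sup>2 - (norm (x - y'))\<^sup>2 = (norm y)\<^sup>2 - (norm y')\<^sup>2 - 2 * (x \<bullet> v)"
          by (simp add: power2_norm_eq_inner v_def inner_diff_left inner_diff_right inner_commute)
        moreover have "\<Phi> t \<bullet> x = t / (pi * \<delta>) * (x \<bullet> v)"
          by (simp add: \<Phi>_def inner_commute)
        ultimately show ?thesis using \<delta> by (simp only: c_def) (simp add: field_simps)
      qed
      have "?L \<le> (\<integral>\<^sup>+t. ennreal (norm (fourier_transform M (\<Phi> t))) \<partial>std_normal)"
      proof (rule oscillatory_average_le[OF prob_space_std_normal])
        show "c \<in> borel_measurable std_normal" "\<Phi> \<in> borel_measurable std_normal"
          unfolding c_def \<Phi>_def by measurable
      qed (simp_all only: phase exp_eq_integral_iexp exp_ge_zero)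
      also have "\<dots> \<le> (\<integral>\<^sup>+t. ennreal (min 1 ((b / \<bar>t\<bar>) powr a)) \<partial>std_normal)"
      proof (intro nn_integral_mono_AE eventually_mono[OF AE_std_normal_neq_0] ennreal_leI)
        fix t :: real assume t: "t \<noteq> 0"
        have "norm (fourier_transform M (\<Phi> t)) \<le> C * norm (\<Phi> t) powr (- a)"
          using t v \<delta> by (intro decay) (simp add: \<Phi>_def)
        also have "C = (C powr (1 / a)) powr a" using assms by (simp add: powr_powr)
        also have "(C powr (1 / a)) powr a * norm (\<Phi> t) powr (- a) = (C powr (1 / a) / norm (\<Phi> t)) powr a"
          by (subst powr_divide) (auto simp: powr_minus_divide)
        also have "C powr (1 / a) / norm (\<Phi> t) = b / \<bar>t\<bar>"
          using t v \<delta> by (simp add: \<Phi>_def b_def B_def field_simps abs_mult)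
        finally show "norm (fourier_transform M (\<Phi> t)) \<le> min 1 ((b / \<bar>t\<bar>) powr a)"
          using norm_fourier_transform_le_1 by simp
      qed
      also have "\<dots> \<le> ennreal (2 * (1 / u + 1 / (a - u)) * b powr u)"
        using assms b by (intro nn_integral_std_normal_truncated_powr) auto
      also have "2 * (1 / u + 1 / (a - u)) * b powr u
          = (2 * (1 / u + 1 / (a - u)) * B powr u * \<delta> powr u) * norm v powr (- u)"
        using B \<delta> v by (simp add: b_def powr_divide powr_mult powr_minus_divide)
      also have "ennreal \<dots> = ennreal (2 * (1 / u + 1 / (a - u)) * B powr u * \<delta> powr u) * ennreal (norm v powr (- u))"
        using assms by (intro ennreal_mult) (auto intro!: mult_nonneg_nonneg add_nonneg_nonneg)
      also have "\<dots> \<le> ennreal (2 * (1 / u + 1 / (a - u)) * B powr u * \<delta> powr u) *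
           (ennreal (2 powr u * exp (1/2)) * (1 + gauss_riesz u (norm v)))"
        using assms v by (intro mult_left_mono powr_neg_le_gauss_riesz) auto
      also have "\<dots> = ennreal (K * \<delta> powr u) * (1 + gauss_riesz u (norm v))"
      proof -
        have "ennreal (2 * (1 / u + 1 / (a - u)) * B powr u * \<delta> powr u) * ennreal (2 powr u * exp (1/2))
          = ennreal (2 * (1 / u + 1 / (a - u)) * B powr u * \<delta> powr u * (2 powr u * exp (1/2)))"
          using assms by (intro ennreal_mult[symmetric]) (auto intro!: mult_nonneg_nonneg add_nonneg_nonneg)
        also have "2 * (1 / u + 1 / (a - u)) * B powr u * \<delta> powr u * (2 powr u * exp (1/2)) = K * \<delta> powr u"
          by (simp add: K_def mult_ac)
        finally show ?thesis by (simp only: mult.assoc[symmetric])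
      qed
      finally show ?thesis by (simp add: v_def)
    qed
  qed
qed

end

context borel_prob_space begin

lemma measurable_square_gap [measurable]:
  "(\<lambda>w. square_gap (fst w) (snd w)) \<in> borel_measurable (M \<Otimes>\<^sub>M (M \<Otimes>\<^sub>M M))"
  "square_gap x \<in> borel_measurable (M \<Otimes>\<^sub>M M)"
  unfolding square_gap_def[abs_def] by measurable

text \<open>The heart of the argument: on average over the pin, the squared distances concentrate at scale
  \<open>\<delta>\<close> no more than a measure of dimension \<open>u\<close> does. The previous bound is integrated over
  \<open>(y, y')\<close>; the kernel has a bounded potential because balls have mass \<open>O(\<delta>\<^sup>p)\<close> for some \<open>p > u\<close>.\<close>

lemma mean_square_gap_gaussian_le:
  assumes "DIM('a) \<ge> 2"
    and decay: "\<And>z. z \<noteq> 0 \<Longrightarrow> norm (fourier_transform M z) \<le> C * norm z powr (- a)"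
    and u: "0 < u" "u \<le> 1" "u < a" and C: "0 < C"
  obtains K where "0 \<le> K" and
    "\<And>\<delta>. 0 < \<delta> \<Longrightarrow>
      (\<integral>\<^sup>+x. \<integral>\<^sup>+p. ennreal (exp (- ((square_gap x p / \<delta>)\<^sup>2) / 2)) \<partial>(M \<Otimes>\<^sub>M M) \<partial>M) \<le> ennreal (K * \<delta> powr u)"
proof -
  interpret MM: pair_prob_space M M ..
  interpret MMM: pair_sigma_finite M "M \<Otimes>\<^sub>M M" ..
  \<comment> \<open>Any exponent in \<open>(u, 2)\<close> not exceeding \<open>a\<close> would do; \<open>3/2\<close> leaves room above \<open>u \<le> 1\<close>.\<close>
  define p where "p = min a (3/2)"
  have p: "u < p" "0 < p" "p < 2" "p \<le> a" using u by (auto simp: p_def)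
  have decay': "norm (fourier_transform M z) \<le> max C 1 * norm z powr (- p)" if "z \<noteq> 0" for z
    by (rule fourier_decay_mono[OF decay p(4) _ that]) (use p in auto)
  obtain K1 where K1: "0 \<le> K1"
    "\<And>\<delta> y'. 0 < \<delta> \<Longrightarrow> (\<integral>\<^sup>+y. ennreal (exp (- ((norm (y - y') / \<delta>)\<^sup>2) / 2)) \<partial>M) \<le> ennreal (K1 * \<delta> powr p)"
  proof (rule gaussian_ball_average_le[OF assms(1)])
    show "norm (fourier_transform M z) \<le> max C 1 * norm z powr (- p)" if "z \<noteq> 0" for z
      by (rule decay'[OF that])
    show "0 < p" "p < 2" by (fact p)+
    show "0 \<le> max C 1" by simp
  qed (rule that)
  obtain K2 where K2: "0 < K2"
    "\<And>\<delta> y y'. 0 < \<delta> \<Longrightarrow>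
      (\<integral>\<^sup>+x. ennreal (exp (- ((((norm (x - y))\<^sup>2 - (norm (x - y'))\<^sup>2) / \<delta>)\<^sup>2) / 2)) \<partial>M)
        \<le> ennreal (K2 * \<delta> powr u) * (1 + gauss_riesz u (norm (y - y')))"
  proof (rule pinned_gaussian_average_le[OF _ u C])
    show "norm (fourier_transform M z) \<le> C * norm z powr (- a)" if "z \<noteq> 0" for z
      by (rule decay[OF that])
  qed (rule that)
  define L where "L = K1 / (1 - 2 powr (u - p))"
  have "2 powr (u - p) < 1" using powr_less_mono[of "u - p" 0 2] p by simp
  then have L: "0 \<le> L" using K1 by (simp add: L_def)
  have pot: "(\<integral>\<^sup>+y'. gauss_riesz u (norm (y - y')) \<partial>M) \<le> ennreal L" for y
    unfolding L_def
    using K1(2)[of _ y] by (intro nn_integral_gauss_riesz_le p K1(1)) (auto simp: norm_minus_commute)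
  have energy: "(\<integral>\<^sup>+q. 1 + gauss_riesz u (norm (fst q - snd q)) \<partial>(M \<Otimes>\<^sub>M M)) \<le> ennreal (1 + L)"
  proof -
    have "(\<integral>\<^sup>+q. gauss_riesz u (norm (fst q - snd q)) \<partial>(M \<Otimes>\<^sub>M M))
      = (\<integral>\<^sup>+y. \<integral>\<^sup>+y'. gauss_riesz u (norm (y - y')) \<partial>M \<partial>M)"
      by (subst nn_integral_fst[symmetric]) auto
    also have "\<dots> \<le> (\<integral>\<^sup>+y. ennreal L \<partial>M)" by (intro nn_integral_mono pot)
    also have "\<dots> = ennreal L" using emeasure_space_1 by simp
    finally have "1 + (\<integral>\<^sup>+q. gauss_riesz u (norm (fst q - snd q)) \<partial>(M \<Otimes>\<^sub>M M)) \<le> 1 + ennreal L"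
      by (rule add_left_mono)
    then show ?thesis
      using L MM.emeasure_space_1 by (subst nn_integral_add) (auto simp: ennreal_plus)
  qed
  show ?thesis
  proof (rule that[of "K2 * (1 + L)"])
    show "0 \<le> K2 * (1 + L)" using K2 L by simp
    fix \<delta> :: real assume \<delta>: "0 < \<delta>"
    have "(\<integral>\<^sup>+x. \<integral>\<^sup>+q. ennreal (exp (- ((square_gap x q / \<delta>)\<^sup>2) / 2)) \<partial>(M \<Otimes>\<^sub>M M) \<partial>M)
       = (\<integral>\<^sup>+q. \<integral>\<^sup>+x. ennreal (exp (- ((square_gap x q / \<delta>)\<^sup>2) / 2)) \<partial>M \<partial>(M \<Otimes>\<^sub>M M))"
      by (intro MMM.Fubini'[symmetric]) (simp add: split_beta')
    also have "\<dots> \<le> (\<integral>\<^sup>+q. ennreal (K2 * \<delta> powr u) * (1 + gauss_riesz u (norm (fst q - snd q))) \<partial>(M \<Otimes>\<^sub>M M))"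
      unfolding square_gap_def by (intro nn_integral_mono K2(2) \<delta>)
    also have "\<dots> = ennreal (K2 * \<delta> powr u) * (\<integral>\<^sup>+q. 1 + gauss_riesz u (norm (fst q - snd q)) \<partial>(M \<Otimes>\<^sub>M M))"
      by (rule nn_integral_cmult) measurable
    also have "\<dots> \<le> ennreal (K2 * \<delta> powr u) * ennreal (1 + L)"
      by (intro mult_left_mono energy) auto
    also have "\<dots> = ennreal (K2 * \<delta> powr u * (1 + L))"
      using K2 L by (intro ennreal_mult[symmetric]) auto
    also have "K2 * \<delta> powr u * (1 + L) = K2 * (1 + L) * \<delta> powr u" by simp
    finally show "(\<integral>\<^sup>+x. \<integral>\<^sup>+q. ennreal (exp (- ((square_gap x q / \<delta>)\<^sup>2) / 2)) \<partial>(M \<Otimes>\<^sub>M M) \<partial>M)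
       \<le> ennreal (K2 * (1 + L) * \<delta> powr u)" .
  qed
qed

end

section \<open>Size of a set from the pairs it makes close\<close>

lemma hausdorff_dim_nonneg: "0 \<le> hausdorff_dim E"
  unfolding hausdorff_dim_def by (intro Inf_greatest) auto

text \<open>The energy method, for the image of a probability measure under \<open>g\<close>. Given a cover of \<open>E\<close>, cut the
  preimages of its members down to disjoint sets \<open>B\<^sub>i\<close> of mass \<open>m\<^sub>i\<close>. The squares \<open>B\<^sub>i \<times> B\<^sub>i\<close>
  are disjoint and each carries energy at least \<open>\<kappa> m\<^sub>i\<^sup>2 / d\<^sub>i\<^sup>u\<close>, so Cauchy-Schwarz bounds
  \<open>1 = (\<Sum> m\<^sub>i)\<^sup>2\<close> by the energy times \<open>(\<Sum> d\<^sub>i\<^sup>u) / \<kappa>\<close>, and the cover cannot be too cheap. The kernel \<open>W\<close>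
  lives on pairs of points rather than of values of \<open>g\<close>, so that it may be built from another
  quantity that \<open>g\<close> controls.\<close>

lemma hausdorff_dim_ge_of_energy:
  fixes M :: "'b measure" and g :: "'b \<Rightarrow> real" and W :: "'b \<times> 'b \<Rightarrow> ennreal"
  assumes "prob_space M" and g [measurable]: "g \<in> borel_measurable M"
    and W [measurable]: "W \<in> borel_measurable (M \<Otimes>\<^sub>M M)"
    and S: "AE y in M. y \<in> S" and S_sets [measurable]: "S \<in> sets M" and gS: "g ` S \<subseteq> E"
    and u: "0 < u" and \<kappa>: "0 < \<kappa>" and \<delta>0: "0 < \<delta>\<^sub>0" "\<delta>\<^sub>0 \<le> 1"
    and W_ge: "\<And>y y' D. y \<in> S \<Longrightarrow> y' \<in> S \<Longrightarrow> 0 < D \<Longrightarrow> D \<le> \<delta>\<^sub>0 \<Longrightarrow> \<bar>g y - g y'\<bar> \<le> D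
      \<Longrightarrow> ennreal (\<kappa> * D powr (- u)) \<le> W (y, y')"
    and fin: "(\<integral>\<^sup>+p. W p \<partial>(M \<Otimes>\<^sub>M M)) < \<infinity>"
  shows "ereal u \<le> hausdorff_dim E"
proof -
  interpret prob_space M by fact
  interpret MM: pair_prob_space M M ..
  obtain I where I: "(\<integral>\<^sup>+p. W p \<partial>(M \<Otimes>\<^sub>M M)) \<le> ennreal I" "1 \<le> I"
  proof -
    obtain J where "(\<integral>\<^sup>+p. W p \<partial>(M \<Otimes>\<^sub>M M)) = ennreal J" "0 \<le> J"
      using fin by (cases "\<integral>\<^sup>+p. W p \<partial>(M \<Otimes>\<^sub>M M)") auto
    then show ?thesis by (intro that[of "J + 1"]) (auto intro: ennreal_leI)
  qed
  have cover: "ennreal (\<kappa> / I) \<le> (\<Sum>i. diam_pow s (U i))"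
    if s: "0 \<le> s" "s \<le> u" and U: "E \<subseteq> (\<Union>i. U i)" "\<And>i. bounded (U i)" "\<And>i. diameter (U i) \<le> \<delta>\<^sub>0"
    for s and U :: "nat \<Rightarrow> real set"
  proof -
    define d where "d i = diameter (U i)" for i
    \<comment> \<open>Closures have the same diameters and make the preimages measurable; the cover itself is arbitrary.\<close>
    define V where "V i = {y \<in> space M. y \<in> S \<and> g y \<in> closure (U i)}" for i
    define B where "B = disjointed V"
    define m where "m i = measure M (B i)" for i
    define J where "J i = (\<integral>\<^sup>+p. W p * indicator (B i \<times> B i) p \<partial>(M \<Otimes>\<^sub>M M))" for i
    have Vs: "V i \<in> sets M" for i
    proof -
      have "V i = (g -` closure (U i) \<inter> space M) \<inter> S" by (auto simp: V_def)
      then show ?thesis using measurable_sets[OF g, of "closure (U i)"] S_sets by simp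
    qed
    then have Bs [measurable]: "B i \<in> sets M" for i
      unfolding B_def using sets.range_disjointed_sets[of V M] by auto
    have BV: "B i \<subseteq> V i" for i unfolding B_def by (rule disjointed_subset)
    have Bd: "disjoint_family B" unfolding B_def by (rule disjoint_family_disjointed)
    have near: "y \<in> S \<and> y' \<in> S \<and> \<bar>g y - g y'\<bar> \<le> d i" if "y \<in> B i" "y' \<in> B i" for y y' i
      using BV[of i] that diameter_bounded_bound[OF bounded_closure[OF U(2)], of "g y" i "g y'"]
      by (auto simp: V_def d_def dist_real_def diameter_closure[OF U(2)])
    have J_le: "J i \<le> ennreal I" for i
    proof -
      have "J i \<le> (\<integral>\<^sup>+p. W p \<partial>(M \<Otimes>\<^sub>M M))"
        unfolding J_def by (intro nn_integral_mono) (auto simp: indicator_def)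
      then show ?thesis using I by simp
    qed
    have J_ge: "ennreal (\<kappa> * D powr (- u) * (m i)\<^sup>2) \<le> J i" if "d i \<le> D" "0 < D" "D \<le> \<delta>\<^sub>0" for i D
    proof -
      have "ennreal (\<kappa> * D powr (- u) * (m i)\<^sup>2) = ennreal (\<kappa> * D powr (- u)) * (emeasure M (B i) * emeasure M (B i))"
        using \<kappa> by (simp add: emeasure_eq_measure m_def ennreal_mult[symmetric] power2_eq_square)
      also have "\<dots> = ennreal (\<kappa> * D powr (- u)) * emeasure (M \<Otimes>\<^sub>M M) (B i \<times> B i)"
        by (simp add: emeasure_pair_measure_Times)
      also have "\<dots> = (\<integral>\<^sup>+p. ennreal (\<kappa> * D powr (- u)) * indicator (B i \<times> B i) p \<partial>(M \<Otimes>\<^sub>M M))"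
        by (rule nn_integral_cmult_indicator[symmetric]) simp
      also have "\<dots> \<le> J i"
        unfolding J_def using that near W_ge
        by (intro nn_integral_mono) (fastforce simp: indicator_def)
      finally show ?thesis .
    qed
    \<comment> \<open>Cauchy-Schwarz termwise, as \<open>2 m \<le> A m\<^sup>2 + 1 / A\<close> with \<open>A = \<kappa> d\<^sup>-\<^sup>u / I\<close>.\<close>
    have single: "2 * ennreal (m i) \<le> ennreal (1 / I) * J i + ennreal (I / \<kappa>) * diam_pow s (U i)" for i
    proof (cases "m i = 0")
      case False
      then have m: "0 < m i" by (simp add: m_def less_le)
      then have "B i \<noteq> {}" by (auto simp: m_def)
      then have ne: "U i \<noteq> {}" using BV[of i] by (auto simp: V_def)
      have d0: "0 \<le> d i" unfolding d_def by (rule diameter_ge_0[OF U(2)])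
      have "d i \<noteq> 0"
      proof
        \<comment> \<open>Mass over a set of diameter 0 would have infinite energy: \<open>D\<close> is so small that \<open>\<kappa> D\<^sup>-\<^sup>u m\<^sup>2 > I\<close>.\<close>
        assume 0: "d i = 0"
        define X where "X = (I + 1) / (\<kappa> * (m i)\<^sup>2)"
        define D where "D = min \<delta>\<^sub>0 (X powr (- 1 / u))"
        have X: "0 < X" using I \<kappa> m by (simp add: X_def)
        have D: "0 < D" "D \<le> \<delta>\<^sub>0" using X \<delta>0 by (auto simp: D_def)
        have "X = (X powr (- 1 / u)) powr (- u)" using X u by (simp add: powr_powr)
        also have "\<dots> \<le> D powr (- u)" using D u by (intro powr_mono2') (auto simp: D_def)
        finally have "\<kappa> * X * (m i)\<^sup>2 \<le> \<kappa> * D powr (- u) * (m i)\<^sup>2"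
          using \<kappa> by (intro mult_right_mono mult_left_mono) auto
        moreover have "\<kappa> * X * (m i)\<^sup>2 = I + 1" using \<kappa> m by (simp add: X_def)
        ultimately have "ennreal (I + 1) \<le> ennreal (\<kappa> * D powr (- u) * (m i)\<^sup>2)"
          by (intro ennreal_leI) simp
        also have "\<dots> \<le> ennreal I" using order_trans[OF J_ge[of i D] J_le[of i]] D 0 by simp
        finally show False using I by simp
      qed
      with d0 have d: "0 < d i" by simp
      obtain j where j: "J i = ennreal j" "0 \<le> j" using J_le[of i] by (cases "J i") (auto simp: top_unique)
      have dle: "d i \<le> \<delta>\<^sub>0" using U(3) by (simp add: d_def)
      have "ennreal (\<kappa> * d i powr (- u) * (m i)\<^sup>2) \<le> ennreal j" using J_ge[of i "d i"] d dle j by simp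
      then have jm: "\<kappa> * d i powr (- u) * (m i)\<^sup>2 \<le> j" using j by simp
      define A where "A = \<kappa> * d i powr (- u) / I"
      have A: "0 < A" using \<kappa> d I by (simp add: A_def)
      have "0 \<le> (A * m i - 1)\<^sup>2 / A" using A by simp
      also have "\<dots> = A * (m i)\<^sup>2 - 2 * m i + 1 / A" using A by (simp add: power2_eq_square field_simps)
      finally have "2 * m i \<le> A * (m i)\<^sup>2 + 1 / A" by simp
      also have "A * (m i)\<^sup>2 \<le> 1 / I * j" using jm I by (simp add: A_def divide_right_mono)
      also have "1 / A = I / \<kappa> * d i powr u" using d by (simp add: A_def powr_minus divide_inverse)
      also have "I / \<kappa> * d i powr u \<le> I / \<kappa> * d i powr s"
        using I \<kappa> s d dle \<delta>0 by (intro mult_left_mono powr_mono') auto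
      finally have "2 * m i \<le> 1 / I * j + I / \<kappa> * d i powr s" by simp
      then have "ennreal (2 * m i) \<le> ennreal (1 / I * j + I / \<kappa> * d i powr s)" by (rule ennreal_leI)
      also have "\<dots> = ennreal (1 / I) * J i + ennreal (I / \<kappa>) * ennreal (d i powr s)"
        using I \<kappa> j by (simp add: ennreal_plus ennreal_mult[symmetric])
      also have "ennreal (d i powr s) = diam_pow s (U i)"
        using ne d by (simp add: diam_pow_def d_def)
      finally show ?thesis using m by (simp add: ennreal_mult)
    qed simp
    have "AE y in M. y \<in> (\<Union>i. B i)"
      using S AE_space
    proof eventually_elim
      case (elim y)
      then have "g y \<in> (\<Union>i. U i)" using gS U(1) by auto
      then have "y \<in> (\<Union>i. V i)" using elim closure_subset by (fastforce simp: V_def)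
      then show ?case unfolding B_def by (simp add: UN_disjointed_eq)
    qed
    then have "emeasure M (\<Union>i. B i) = 1"
      by (intro emeasure_eq_1_AE) auto
    moreover have "(\<Sum>i. emeasure M (B i)) = emeasure M (\<Union>i. B i)"
      using Bd by (intro suminf_emeasure) auto
    ultimately have "(\<Sum>i. ennreal (m i)) = 1"
      by (simp only: m_def emeasure_eq_measure[symmetric])
    then have "2 = (\<Sum>i. 2 * ennreal (m i))" by (simp only: ennreal_suminf_cmult mult_1_right)
    also have "\<dots> \<le> (\<Sum>i. ennreal (1 / I) * J i + ennreal (I / \<kappa>) * diam_pow s (U i))"
      by (intro suminf_le single) auto
    also have "\<dots> = ennreal (1 / I) * (\<Sum>i. J i) + ennreal (I / \<kappa>) * (\<Sum>i. diam_pow s (U i))"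
      by (subst suminf_add[symmetric]) auto
    also have "(\<Sum>i. J i) \<le> ennreal I"
    proof -
      have "(\<Sum>i. J i) = (\<integral>\<^sup>+p. (\<Sum>i. W p * indicator (B i \<times> B i) p) \<partial>(M \<Otimes>\<^sub>M M))"
        unfolding J_def by (rule nn_integral_suminf[symmetric]) measurable
      also have "\<dots> \<le> (\<integral>\<^sup>+p. W p \<partial>(M \<Otimes>\<^sub>M M))"
      proof (rule nn_integral_mono)
        fix p
        have dB: "disjoint_family (\<lambda>i. B i \<times> B i)"
          using Bd by (simp add: disjoint_family_on_def Times_Int_Times)
        show "(\<Sum>i. W p * indicator (B i \<times> B i) p) \<le> W p"
        proof (cases "\<exists>i. p \<in> B i \<times> B i")
          case True
          then obtain i where "p \<in> B i \<times> B i" by blast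
          then show ?thesis using suminf_cmult_indicator[OF dB, of p i "\<lambda>_. W p"] by simp
        next
          case False
          then have "(\<lambda>i. W p * indicator (B i \<times> B i) p) = (\<lambda>i. 0)" by (auto simp: indicator_def)
          then show ?thesis by simp
        qed
      qed
      finally show ?thesis using I by simp
    qed
    then have "ennreal (1 / I) * (\<Sum>i. J i) + ennreal (I / \<kappa>) * (\<Sum>i. diam_pow s (U i))
       \<le> ennreal (1 / I) * ennreal I + ennreal (I / \<kappa>) * (\<Sum>i. diam_pow s (U i))"
      by (intro add_mono mult_left_mono) auto
    also have "ennreal (1 / I) * ennreal I = 1" using I by (simp add: ennreal_mult[symmetric])
    finally have two: "2 \<le> 1 + ennreal (I / \<kappa>) * (\<Sum>i. diam_pow s (U i))" .
    show ?thesis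
    proof (cases "\<Sum>i. diam_pow s (U i)")
      case (real r)
      then have "ennreal 2 \<le> ennreal (1 + I / \<kappa> * r)"
      proof -
        have "ennreal (I / \<kappa> * r) = ennreal (I / \<kappa>) * ennreal r"
          using I \<kappa> real by (intro ennreal_mult) auto
        moreover have "ennreal (1 + I / \<kappa> * r) = ennreal 1 + ennreal (I / \<kappa> * r)"
          using I \<kappa> real by (intro ennreal_plus) auto
        ultimately show ?thesis using two by (simp only: real(2) ennreal_1 ennreal_numeral)
      qed
      moreover have "0 \<le> 1 + I / \<kappa> * r" using I \<kappa> real by simp
      ultimately have "2 \<le> 1 + I / \<kappa> * r" by (simp only: ennreal_le_iff)
      then have "1 \<le> I / \<kappa> * r" by linarith
      then show ?thesis using real I \<kappa> by (intro ord_le_eq_trans[OF ennreal_leI real(2)[symmetric]]) (simp add: field_simps)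
    qed simp
  qed
  show ?thesis
    unfolding hausdorff_dim_def
  proof (rule Inf_greatest)
    fix t assume "t \<in> {ereal s |s. 0 \<le> s \<and> hausdorff_measure s E = 0}"
    then obtain s where s: "t = ereal s" "0 \<le> s" "hausdorff_measure s E = 0" by blast
    have "u \<le> s"
    proof (rule ccontr)
      assume "\<not> u \<le> s"
      then have "ennreal (\<kappa> / I) \<le> hausdorff_premeasure s \<delta>\<^sub>0 E"
        unfolding hausdorff_premeasure_def using s by (intro INF_greatest cover) auto
      also have "\<dots> \<le> hausdorff_measure s E"
        unfolding hausdorff_measure_def using \<delta>0 by (intro SUP_upper) auto
      finally show False using s I \<kappa> by (simp add: ennreal_eq_0_iff divide_le_0_iff)
    qed
    then show "ereal u \<le> t" using s by simp
  qed
qed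

text \<open>Let \<open>H r\<close> be the mass of the points with \<open>|g y - r| \<le> \<delta>\<close>. Its integral is \<open>2 \<delta>\<close>, and its square
  integrates to at most \<open>2 \<delta>\<close> times the mass of the pairs that \<open>g\<close> brings within \<open>2 \<delta>\<close>, hence to \<open>O(\<delta>\<^sup>2)\<close>.
  By Cauchy-Schwarz the neighbourhood of \<open>E\<close> that supports \<open>H\<close> has measure bounded below, uniformly
  along the good scales; compactness of \<open>E\<close> lets such neighbourhoods shrink into open sets
  of measure close to that of \<open>E\<close>.\<close>

lemma emeasure_pos_of_close_pairs:
  fixes M :: "'b measure" and g :: "'b \<Rightarrow> real" and \<delta> :: "nat \<Rightarrow> real"
  assumes "prob_space M" and g [measurable]: "g \<in> borel_measurable M"
    and E: "compact E" "AE y in M. g y \<in> E"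
    and \<delta>: "\<And>n. 0 < \<delta> n" "\<delta> \<longlonglongrightarrow> 0" and C: "0 < C"
    and freq: "\<exists>\<^sub>F n in sequentially. (\<integral>\<^sup>+y. \<integral>\<^sup>+y'. (if \<bar>g y - g y'\<bar> \<le> 2 * \<delta> n then 1 else 0) \<partial>M \<partial>M) \<le> ennreal (C * \<delta> n)"
  shows "0 < emeasure lborel E"
proof (rule ccontr)
  interpret prob_space M by fact
  interpret LM: pair_sigma_finite lborel M ..
  assume "\<not> 0 < emeasure lborel E"
  then have E0: "emeasure lborel E = 0" by simp
  have Eb: "E \<in> sets lborel" using E(1) by (simp add: borel_compact)
  obtain U where U: "open U" "E \<subseteq> U" "emeasure lborel (U - E) < ennreal (2 / C)"
    using outer_regular_lborel[of E "2 / C"] Eb C by auto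
  have "emeasure lborel U \<le> emeasure lborel (U - E) + emeasure lborel E"
    using U(1,2) Eb by (subst plus_emeasure) (auto intro!: emeasure_mono)
  with U(3) E0 have Ul: "emeasure lborel U < ennreal (2 / C)" by simp
  obtain \<rho> where \<rho>: "0 < \<rho>" "(\<Union>x\<in>E. ball x \<rho>) \<subseteq> U"
    using compact_subset_open_imp_ball_epsilon_subset[OF E(1) U(1,2)] by blast
  have "\<forall>\<^sub>F n in sequentially. \<delta> n < \<rho>" using \<delta>(2) \<rho>(1) by (rule order_tendstoD)
  from frequently_eventually_conj[OF freq this] obtain n where
    n: "(\<integral>\<^sup>+y. \<integral>\<^sup>+y'. (if \<bar>g y - g y'\<bar> \<le> 2 * \<delta> n then 1 else 0) \<partial>M \<partial>M) \<le> ennreal (C * \<delta> n)" "\<delta> n < \<rho>"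
    using frequently_ex by blast
  define e where "e = \<delta> n"
  have e: "0 < e" "e < \<rho>" using \<delta> n by (auto simp: e_def)
  define k :: "real \<Rightarrow> 'b \<Rightarrow> ennreal" where "k r y = (if \<bar>g y - r\<bar> \<le> e then 1 else 0)" for r y
  have k [measurable]: "(\<lambda>p. k (fst p) (snd p)) \<in> borel_measurable (lborel \<Otimes>\<^sub>M M)"
    unfolding k_def by measurable
  have k' [measurable]: "(\<lambda>y. k r y) \<in> borel_measurable M" for r unfolding k_def by measurable
  define H where "H r = (\<integral>\<^sup>+y. k r y \<partial>M)" for r
  have Hm [measurable]: "H \<in> borel_measurable borel"
    unfolding H_def k_def by measurable
  have H1: "H r \<le> 1" for r
  proof -
    have "H r \<le> (\<integral>\<^sup>+y. 1 \<partial>M)" unfolding H_def by (intro nn_integral_mono) (simp add: k_def)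
    then show ?thesis by (simp add: emeasure_space_1)
  qed
  have kr: "(\<integral>\<^sup>+r. k r y \<partial>lborel) = ennreal (2 * e)" for y
  proof -
    have "(\<integral>\<^sup>+r. k r y \<partial>lborel) = (\<integral>\<^sup>+r. indicator {g y - e..g y + e} r \<partial>lborel)"
      by (intro nn_integral_cong) (auto simp: k_def indicator_def abs_le_iff)
    then show ?thesis using e by simp
  qed
  have intH: "(\<integral>\<^sup>+r. H r \<partial>lborel) = ennreal (2 * e)"
  proof -
    have "(\<integral>\<^sup>+r. H r \<partial>lborel) = (\<integral>\<^sup>+y. \<integral>\<^sup>+r. k r y \<partial>lborel \<partial>M)"
      unfolding H_def using k by (intro LM.Fubini'[symmetric]) (simp add: split_beta')
    then show ?thesis by (simp add: kr emeasure_space_1)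
  qed
  have intH2: "(\<integral>\<^sup>+r. H r * H r \<partial>lborel) \<le> ennreal (2 * e) * ennreal (C * e)"
  proof -
    have "(\<integral>\<^sup>+r. H r * H r \<partial>lborel) = (\<integral>\<^sup>+r. \<integral>\<^sup>+y. k r y * H r \<partial>M \<partial>lborel)"
      by (subst nn_integral_multc) (auto simp: H_def[symmetric])
    also have "\<dots> = (\<integral>\<^sup>+y. \<integral>\<^sup>+r. k r y * H r \<partial>lborel \<partial>M)"
      by (intro LM.Fubini'[symmetric]) (simp add: split_beta')
    also have "\<dots> = (\<integral>\<^sup>+y. \<integral>\<^sup>+r. \<integral>\<^sup>+y'. k r y * k r y' \<partial>M \<partial>lborel \<partial>M)"
      by (simp add: H_def nn_integral_cmult)
    also have "\<dots> = (\<integral>\<^sup>+y. \<integral>\<^sup>+y'. \<integral>\<^sup>+r. k r y * k r y' \<partial>lborel \<partial>M \<partial>M)"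
      by (intro nn_integral_cong LM.Fubini'[symmetric]) (simp add: k_def split_beta')
    also have "\<dots> \<le> (\<integral>\<^sup>+y. \<integral>\<^sup>+y'. ennreal (2 * e) * (if \<bar>g y - g y'\<bar> \<le> 2 * e then 1 else 0) \<partial>M \<partial>M)"
    proof (intro nn_integral_mono)
      fix y y'
      have "(\<integral>\<^sup>+r. k r y * k r y' \<partial>lborel) \<le> (\<integral>\<^sup>+r. k r y * (if \<bar>g y - g y'\<bar> \<le> 2 * e then 1 else 0) \<partial>lborel)"
        by (intro nn_integral_mono) (auto simp: k_def)
      also have "\<dots> = ennreal (2 * e) * (if \<bar>g y - g y'\<bar> \<le> 2 * e then 1 else 0)"
        using kr[of y] by auto
      finally show "(\<integral>\<^sup>+r. k r y * k r y' \<partial>lborel) \<le> ennreal (2 * e) * (if \<bar>g y - g y'\<bar> \<le> 2 * e then 1 else 0)" .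
    qed
    also have "\<dots> = ennreal (2 * e) * (\<integral>\<^sup>+y. \<integral>\<^sup>+y'. (if \<bar>g y - g y'\<bar> \<le> 2 * e then 1 else 0) \<partial>M \<partial>M)"
      by (simp add: nn_integral_cmult)
    also have "\<dots> \<le> ennreal (2 * e) * ennreal (C * e)"
      using n by (intro mult_left_mono) (auto simp: e_def)
    finally show ?thesis .
  qed
  \<comment> \<open>Cauchy-Schwarz pointwise, as \<open>2 \<lambda> H \<le> H\<^sup>2 + \<lambda>\<^sup>2\<close> on \<open>U\<close> with the optimal \<open>\<lambda> = C e\<close>; off \<open>U\<close> the function \<open>H\<close> vanishes.\<close>
  have pw: "ennreal (2 * (C * e)) * H r \<le> H r * H r + ennreal ((C * e)\<^sup>2) * indicator U r" for r
  proof (cases "r \<in> U")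
    case True
    obtain h where h: "H r = ennreal h" "0 \<le> h" using H1[of r] by (cases "H r") (auto simp: top_unique)
    have "0 \<le> (h - C * e)\<^sup>2" by simp
    then have "2 * (C * e) * h \<le> h * h + (C * e)\<^sup>2"
      by (simp only: power2_diff) (simp add: power2_eq_square algebra_simps)
    then have "ennreal (2 * (C * e) * h) \<le> ennreal (h * h + (C * e)\<^sup>2)" by (rule ennreal_leI)
    then show ?thesis using True h C e by (simp add: ennreal_mult ennreal_plus)
  next
    case False
    have "AE y in M. k r y = 0"
      using E(2)
    proof eventually_elim
      case (elim y)
      with \<rho>(2) False have "r \<notin> ball (g y) \<rho>" by blast
      then show ?case using e by (auto simp: k_def dist_real_def)
    qed
    then have "H r = 0" unfolding H_def by (subst nn_integral_0_iff_AE) auto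
    then show ?thesis by simp
  qed
  have "ennreal (2 * (C * e)) * ennreal (2 * e) = (\<integral>\<^sup>+r. ennreal (2 * (C * e)) * H r \<partial>lborel)"
    by (simp add: nn_integral_cmult intH)
  also have "\<dots> \<le> (\<integral>\<^sup>+r. H r * H r + ennreal ((C * e)\<^sup>2) * indicator U r \<partial>lborel)"
    by (intro nn_integral_mono pw)
  also have "\<dots> = (\<integral>\<^sup>+r. H r * H r \<partial>lborel) + ennreal ((C * e)\<^sup>2) * emeasure lborel U"
    using U(1) by (subst nn_integral_add) (auto simp: nn_integral_cmult_indicator)
  also have "\<dots> \<le> ennreal (2 * e) * ennreal (C * e) + ennreal ((C * e)\<^sup>2) * emeasure lborel U"
    by (intro add_mono intH2) auto
  finally have fin: "ennreal (2 * (C * e)) * ennreal (2 * e) \<le> \<dots>" .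
  obtain l where l: "emeasure lborel U = ennreal l" "0 \<le> l" using Ul by (cases "emeasure lborel U") auto
  have "ennreal (2 * (C * e) * (2 * e)) \<le> ennreal (2 * e * (C * e) + (C * e)\<^sup>2 * l)"
  proof -
    have "ennreal (2 * (C * e) * (2 * e)) = ennreal (2 * (C * e)) * ennreal (2 * e)"
      using C e by (intro ennreal_mult) auto
    also note fin
    also have "ennreal (2 * e) * ennreal (C * e) = ennreal (2 * e * (C * e))"
      using C e by (intro ennreal_mult[symmetric]) auto
    also have "ennreal ((C * e)\<^sup>2) * emeasure lborel U = ennreal ((C * e)\<^sup>2 * l)"
      using l by (simp only: ennreal_mult[symmetric] zero_le_power2)
    also have "ennreal (2 * e * (C * e)) + ennreal ((C * e)\<^sup>2 * l) = ennreal (2 * e * (C * e) + (C * e)\<^sup>2 * l)"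
      using C e l by (intro ennreal_plus[symmetric]) auto
    finally show ?thesis .
  qed
  then have "2 * (C * e) * (2 * e) \<le> 2 * e * (C * e) + (C * e)\<^sup>2 * l"
    using C e l by (subst (asm) ennreal_le_iff) auto
  then have "C * e * e * 2 \<le> C * e * e * (C * l)" by (simp add: power2_eq_square algebra_simps)
  then have "2 \<le> C * l" using C e by (subst (asm) mult_le_cancel_left_pos) auto
  moreover have "l < 2 / C" using Ul l C by (simp add: ennreal_less_iff)
  ultimately show False using C by (simp add: field_simps)
qed

section \<open>Pinned distance sets under Fourier decay\<close>

context borel_prob_space begin

text \<open>The exponent \<open>u\<close> strictly between \<open>v\<close> and \<open>min a 1\<close> provides the room that the summation over
  scales consumes.\<close>

lemma pinned_hausdorff_dim_ge_of_decay:
  assumes "DIM('a) \<ge> 2" and S: "compact (measure_support M)"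
    and decay: "\<And>z. z \<noteq> 0 \<Longrightarrow> norm (fourier_transform M z) \<le> C * norm z powr (- a)"
    and "0 < C" and v: "0 < v" "v < 1" "v < a"
  shows "AE x in M. ereal v \<le> hausdorff_dim (pinned_distance_set x (measure_support M))"
proof -
  interpret MM: pair_prob_space M M ..
  define S where "S = measure_support M"
  have bS: "bounded S" using S by (simp add: S_def compact_imp_bounded)
  have mS: "S \<in> sets M" using S by (simp add: S_def sets_borel borel_compact)
  define u where "u = (v + min a 1) / 2"
  have u: "0 < u" "u \<le> 1" "u < a" "v < u" using v by (auto simp: u_def)
  obtain K where K: "0 \<le> K" "\<And>\<delta>. 0 < \<delta> \<Longrightarrow>
      (\<integral>\<^sup>+x. \<integral>\<^sup>+p. ennreal (exp (- ((square_gap x p / \<delta>)\<^sup>2) / 2)) \<partial>(M \<Otimes>\<^sub>M M) \<partial>M) \<le> ennreal (K * \<delta> powr u)"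
    using mean_square_gap_gaussian_le[OF assms(1) decay u(1-3) assms(4)] by metis
  have "(\<integral>\<^sup>+w. gauss_riesz v (square_gap (fst w) (snd w)) \<partial>(M \<Otimes>\<^sub>M (M \<Otimes>\<^sub>M M))) \<le> ennreal (K / (1 - 2 powr (v - u)))"
  proof (rule nn_integral_gauss_riesz_le[OF _ u(4) K(1)])
    fix \<delta> :: real assume "0 < \<delta>"
    have "(\<integral>\<^sup>+w. ennreal (exp (- ((square_gap (fst w) (snd w) / \<delta>)\<^sup>2) / 2)) \<partial>(M \<Otimes>\<^sub>M (M \<Otimes>\<^sub>M M)))
       = (\<integral>\<^sup>+x. \<integral>\<^sup>+p. ennreal (exp (- ((square_gap x p / \<delta>)\<^sup>2) / 2)) \<partial>(M \<Otimes>\<^sub>M M) \<partial>M)"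
      by (subst MM.nn_integral_fst[symmetric]) auto
    with K(2)[OF \<open>0 < \<delta>\<close>]
    show "(\<integral>\<^sup>+w. ennreal (exp (- ((square_gap (fst w) (snd w) / \<delta>)\<^sup>2) / 2)) \<partial>(M \<Otimes>\<^sub>M (M \<Otimes>\<^sub>M M))) \<le> ennreal (K * \<delta> powr u)"
      by simp
  qed measurable
  also have "(\<integral>\<^sup>+w. gauss_riesz v (square_gap (fst w) (snd w)) \<partial>(M \<Otimes>\<^sub>M (M \<Otimes>\<^sub>M M)))
    = (\<integral>\<^sup>+x. \<integral>\<^sup>+p. gauss_riesz v (square_gap x p) \<partial>(M \<Otimes>\<^sub>M M) \<partial>M)"
    by (subst MM.nn_integral_fst[symmetric]) auto
  finally have "(\<integral>\<^sup>+x. \<integral>\<^sup>+p. gauss_riesz v (square_gap x p) \<partial>(M \<Otimes>\<^sub>M M) \<partial>M) \<noteq> \<infinity>"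
    by (auto simp: top_unique)
  then have "AE x in M. (\<integral>\<^sup>+p. gauss_riesz v (square_gap x p) \<partial>(M \<Otimes>\<^sub>M M)) \<noteq> \<infinity>"
    by (intro nn_integral_PInf_AE) measurable
  with AE_measure_support show ?thesis
  proof eventually_elim
    case (elim x)
    then have x: "x \<in> S" by (simp add: S_def)
    define R where "R = diameter S + 1"
    have R: "1 \<le> R" using diameter_ge_0[OF bS] by (simp add: R_def)
    define c where "c = 2 powr v * exp (1/2)"
    have c: "0 < c" by (simp add: c_def)
    show ?case
    proof (rule hausdorff_dim_ge_of_energy[where g="\<lambda>y. norm (x - y)" and S=S and M=M
          and W="\<lambda>p. gauss_riesz v (square_gap x p)" and \<kappa>="(2 * R) powr (- v) / c" and \<delta>\<^sub>0="1 / (2 * R)"])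
      show "prob_space M" by (rule prob_space_axioms)
      show "AE y in M. y \<in> S" using AE_measure_support by (simp add: S_def)
      show "(\<lambda>y. norm (x - y)) ` S \<subseteq> pinned_distance_set x (measure_support M)"
        by (auto simp: pinned_distance_set_def S_def)
      show "(\<integral>\<^sup>+p. gauss_riesz v (square_gap x p) \<partial>(M \<Otimes>\<^sub>M M)) < \<infinity>"
        using elim(2) by (simp add: less_top)
      fix y y' D assume y: "y \<in> S" "y' \<in> S" and D: "0 < D" "D \<le> 1 / (2 * R)"
        and g: "\<bar>norm (x - y) - norm (x - y')\<bar> \<le> D"
      have "\<bar>square_gap x (y, y')\<bar> \<le> 2 * R * \<bar>norm (x - y) - norm (x - y')\<bar>"
        using square_gap_le[OF bS x y] by (simp add: R_def)
      also have "\<dots> \<le> 2 * R * D" using g R by (intro mult_left_mono) auto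
      finally have gap: "\<bar>square_gap x (y, y')\<bar> \<le> 2 * R * D" .
      have RD: "0 < 2 * R * D" "2 * R * D \<le> 1" using D R by (auto simp: field_simps)
      have le: "ennreal ((2 * R * D) powr (- v)) \<le> ennreal c * gauss_riesz v (square_gap x (y, y'))"
        unfolding c_def using v RD gap by (intro powr_le_gauss_riesz) auto
      have "(2 * R) powr (- v) / c * D powr (- v) = 1 / c * (2 * R * D) powr (- v)"
        using D R by (simp add: powr_mult)
      then have "ennreal ((2 * R) powr (- v) / c * D powr (- v)) = ennreal (1 / c) * ennreal ((2 * R * D) powr (- v))"
        using c by (simp only: ennreal_mult' powr_ge_zero divide_nonneg_pos zero_le_one)
      also have "\<dots> \<le> ennreal (1 / c) * (ennreal c * gauss_riesz v (square_gap x (y, y')))"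
        by (intro mult_left_mono le) auto
      also have "\<dots> = ennreal (1 / c * c) * gauss_riesz v (square_gap x (y, y'))"
        using c by (subst ennreal_mult) (auto simp: mult.assoc)
      also have "\<dots> = gauss_riesz v (square_gap x (y, y'))" using c by simp
      finally show "ennreal ((2 * R) powr (- v) / c * D powr (- v)) \<le> gauss_riesz v (square_gap x (y, y'))" .
    qed (use mS v R c in \<open>auto\<close>)
  qed
qed

text \<open>With \<open>u = 1\<close> no room is left to sum over the scales, but Fatou's lemma still gives
  a bound of the right order along a sequence of scales that depends on the pin.\<close>

lemma pinned_emeasure_pos_of_decay:
  assumes "DIM('a) \<ge> 2" and S: "compact (measure_support M)"
    and decay: "\<And>z. z \<noteq> 0 \<Longrightarrow> norm (fourier_transform M z) \<le> C * norm z powr (- a)"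
    and "0 < C" "1 < a"
  shows "AE x in M. 0 < emeasure lebesgue (pinned_distance_set x (measure_support M))"
proof -
  interpret MM: pair_prob_space M M ..
  define S where "S = measure_support M"
  have bS: "bounded S" using S by (simp add: S_def compact_imp_bounded)
  define e where "e n = inverse (real (Suc n))" for n
  have e: "0 < e n" for n by (simp add: e_def)
  obtain K where K: "0 \<le> K" "\<And>\<delta>. 0 < \<delta> \<Longrightarrow>
      (\<integral>\<^sup>+x. \<integral>\<^sup>+p. ennreal (exp (- ((square_gap x p / \<delta>)\<^sup>2) / 2)) \<partial>(M \<Otimes>\<^sub>M M) \<partial>M) \<le> ennreal (K * \<delta> powr 1)"
    using mean_square_gap_gaussian_le[OF assms(1) decay _ _ assms(5,4)] by (metis order_refl zero_less_one)
  define f where "f n x = ennreal (1 / e n) * (\<integral>\<^sup>+p. ennreal (exp (- ((square_gap x p / e n)\<^sup>2) / 2)) \<partial>(M \<Otimes>\<^sub>M M))" for n x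
  have fm [measurable]: "f n \<in> borel_measurable M" for n unfolding f_def by measurable
  have "(\<integral>\<^sup>+x. f n x \<partial>M) \<le> ennreal K" for n
  proof -
    have "(\<integral>\<^sup>+x. f n x \<partial>M) = ennreal (1 / e n) * (\<integral>\<^sup>+x. \<integral>\<^sup>+p. ennreal (exp (- ((square_gap x p / e n)\<^sup>2) / 2)) \<partial>(M \<Otimes>\<^sub>M M) \<partial>M)"
      unfolding f_def by (rule nn_integral_cmult) measurable
    also have "\<dots> \<le> ennreal (1 / e n) * ennreal (K * e n powr 1)"
      by (intro mult_left_mono K(2) e) auto
    also have "\<dots> = ennreal (1 / e n * (K * e n powr 1))"
      using e[of n] K(1) by (intro ennreal_mult[symmetric]) auto
    also have "1 / e n * (K * e n powr 1) = K" using e[of n] by simp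
    finally show ?thesis .
  qed
  then have "liminf (\<lambda>n. \<integral>\<^sup>+x. f n x \<partial>M) \<le> ennreal K"
    by (intro order_trans[OF Liminf_le_Limsup Limsup_bounded]) auto
  with nn_integral_liminf[of f M] fm have "(\<integral>\<^sup>+x. liminf (\<lambda>n. f n x) \<partial>M) \<le> ennreal K"
    by (blast intro: order_trans)
  then have "(\<integral>\<^sup>+x. liminf (\<lambda>n. f n x) \<partial>M) \<noteq> \<infinity>" by (auto simp: top_unique)
  then have "AE x in M. liminf (\<lambda>n. f n x) \<noteq> \<infinity>"
    by (intro nn_integral_PInf_AE) measurable
  with AE_measure_support show ?thesis
  proof eventually_elim
    case (elim x)
    then have x: "x \<in> S" by (simp add: S_def)
    define R where "R = diameter S + 1"
    have R: "1 \<le> R" using diameter_ge_0[OF bS] by (simp add: R_def)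
    obtain B where B: "liminf (\<lambda>n. f n x) < ennreal B" "0 < B"
    proof -
      obtain b where "liminf (\<lambda>n. f n x) = ennreal b" "0 \<le> b" using elim(2) by (cases "liminf (\<lambda>n. f n x)") auto
      then show ?thesis by (intro that[of "b + 1"]) (auto simp: ennreal_less_iff)
    qed
    have freq: "\<exists>\<^sub>F n in sequentially. f n x < ennreal B"
    proof (rule ccontr)
      assume "\<not> ?thesis"
      then have "\<forall>\<^sub>F n in sequentially. ennreal B \<le> f n x" by (simp add: not_frequently not_less)
      then have "ennreal B \<le> liminf (\<lambda>n. f n x)" by (rule Liminf_bounded)
      with B show False by simp
    qed
    \<comment> \<open>Distances within \<open>2 \<delta> n\<close> of each other have squares within \<open>2 R \<cdot> 2 \<delta> n = e n\<close>.\<close>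
    define \<delta> where "\<delta> n = e n / (4 * R)" for n
    define D where "D = pinned_distance_set x S"
    have D: "D = (\<lambda>y. norm (x - y)) ` S" by (auto simp: D_def pinned_distance_set_def)
    have cD: "compact D"
      unfolding D using S by (intro compact_continuous_image continuous_intros) (simp add: S_def)
    have "0 < emeasure lborel D"
    proof (rule emeasure_pos_of_close_pairs[where g="\<lambda>y. norm (x - y)" and M=M and \<delta>=\<delta> and C="exp (1/2) * B * (4 * R)"])
      show "prob_space M" by (rule prob_space_axioms)
      show "compact D" by (rule cD)
      show "AE y in M. norm (x - y) \<in> D"
        using AE_measure_support by eventually_elim (simp add: D S_def)
      show "0 < \<delta> n" for n using e R by (simp add: \<delta>_def)
      have "e \<longlonglongrightarrow> 0" unfolding e_def[abs_def] by (rule LIMSEQ_inverse_real_of_nat)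
      then have "(\<lambda>n. e n / (4 * R)) \<longlonglongrightarrow> 0 / (4 * R)" by (intro tendsto_intros) (use R in auto)
      then show "\<delta> \<longlonglongrightarrow> 0" by (simp add: \<delta>_def[abs_def])
      show "0 < exp (1/2) * B * (4 * R)" using B R by simp
      show "\<exists>\<^sub>F n in sequentially. (\<integral>\<^sup>+y. \<integral>\<^sup>+y'. (if \<bar>norm (x - y) - norm (x - y')\<bar> \<le> 2 * \<delta> n then 1 else 0) \<partial>M \<partial>M)
          \<le> ennreal (exp (1/2) * B * (4 * R) * \<delta> n)"
        using freq
      proof (rule frequently_mono[rotated], intro allI impI)
        fix n assume fn: "f n x < ennreal B"
        have "(\<integral>\<^sup>+y. \<integral>\<^sup>+y'. (if \<bar>norm (x - y) - norm (x - y')\<bar> \<le> 2 * \<delta> n then 1 else 0) \<partial>M \<partial>M)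
           \<le> (\<integral>\<^sup>+y. \<integral>\<^sup>+y'. ennreal (exp (1/2)) * ennreal (exp (- ((square_gap x (y, y') / e n)\<^sup>2) / 2)) \<partial>M \<partial>M)"
        proof (intro nn_integral_mono_AE eventually_mono[OF AE_measure_support])
          fix y y' assume y: "y \<in> measure_support M" "y' \<in> measure_support M"
          show "(if \<bar>norm (x - y) - norm (x - y')\<bar> \<le> 2 * \<delta> n then 1 else 0)
            \<le> ennreal (exp (1/2)) * ennreal (exp (- ((square_gap x (y, y') / e n)\<^sup>2) / 2))"
          proof (cases "\<bar>norm (x - y) - norm (x - y')\<bar> \<le> 2 * \<delta> n")
            case True
            have "\<bar>square_gap x (y, y')\<bar> \<le> 2 * R * \<bar>norm (x - y) - norm (x - y')\<bar>"
              using square_gap_le[OF bS x, of y y'] y by (simp add: R_def S_def)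
            also have "\<dots> \<le> 2 * R * (2 * \<delta> n)" using True R by (intro mult_left_mono) auto
            also have "\<dots> = e n" using R by (simp add: \<delta>_def)
            finally have "\<bar>square_gap x (y, y') / e n\<bar> \<le> 1" using e[of n] by simp
            then have "(square_gap x (y, y') / e n)\<^sup>2 \<le> 1" by (simp only: abs_square_le_1)
            then have "1 \<le> exp (1/2 + - ((square_gap x (y, y') / e n)\<^sup>2) / 2)" by simp
            then have "ennreal 1 \<le> ennreal (exp (1/2) * exp (- ((square_gap x (y, y') / e n)\<^sup>2) / 2))"
              unfolding exp_add by (rule ennreal_leI)
            also have "\<dots> = ennreal (exp (1/2)) * ennreal (exp (- ((square_gap x (y, y') / e n)\<^sup>2) / 2))"
              by (intro ennreal_mult) auto
            finally show ?thesis using True by simp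
          qed simp
        qed
        also have "\<dots> = (\<integral>\<^sup>+p. ennreal (exp (1/2)) * ennreal (exp (- ((square_gap x p / e n)\<^sup>2) / 2)) \<partial>(M \<Otimes>\<^sub>M M))"
          by (rule nn_integral_fst) measurable
        also have "\<dots> = ennreal (exp (1/2)) * (\<integral>\<^sup>+p. ennreal (exp (- ((square_gap x p / e n)\<^sup>2) / 2)) \<partial>(M \<Otimes>\<^sub>M M))"
          by (rule nn_integral_cmult) measurable
        also have "(\<integral>\<^sup>+p. ennreal (exp (- ((square_gap x p / e n)\<^sup>2) / 2)) \<partial>(M \<Otimes>\<^sub>M M)) = ennreal (e n) * f n x"
        proof -
          have "ennreal (e n) * f n x = (ennreal (e n) * ennreal (1 / e n)) * (\<integral>\<^sup>+p. ennreal (exp (- ((square_gap x p / e n)\<^sup>2) / 2)) \<partial>(M \<Otimes>\<^sub>M M))"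
            by (simp only: f_def mult.assoc)
          also have "ennreal (e n) * ennreal (1 / e n) = 1"
            using e[of n] by (subst ennreal_mult[symmetric]) auto
          finally show ?thesis by simp
        qed
        also have "ennreal (exp (1/2)) * (ennreal (e n) * f n x) \<le> ennreal (exp (1/2)) * (ennreal (e n) * ennreal B)"
          using fn by (intro mult_left_mono) auto
        also have "\<dots> = ennreal (exp (1/2) * (e n * B))"
          using e[of n] B by (simp only: ennreal_mult less_imp_le mult_nonneg_nonneg exp_ge_zero)
        also have "exp (1/2) * (e n * B) = exp (1/2) * B * (4 * R) * \<delta> n"
          using R by (simp add: \<delta>_def)
        finally show "(\<integral>\<^sup>+y. \<integral>\<^sup>+y'. (if \<bar>norm (x - y) - norm (x - y')\<bar> \<le> 2 * \<delta> n then 1 else 0) \<partial>M \<partial>M)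
          \<le> ennreal (exp (1/2) * B * (4 * R) * \<delta> n)" .
      qed
    qed measurable
    then show ?case using cD by (simp add: D_def S_def borel_compact emeasure_completion)
  qed
qed

lemma decay_of_less_fourier_dim:
  assumes "ereal s < fourier_dim M"
  obtains C t where "0 < C" "s < t" "\<And>z. z \<noteq> 0 \<Longrightarrow> norm (fourier_transform M z) \<le> C * norm z powr (- (t / 2))"
proof -
  obtain t where t: "s < t"
    "(SUP z. ennreal ((norm (fourier_transform M z))\<^sup>2 * norm z powr t)) < \<infinity>"
    using assms unfolding fourier_dim_def less_Sup_iff by auto
  then obtain b where b: "(SUP z. ennreal ((norm (fourier_transform M z))\<^sup>2 * norm z powr t)) = ennreal b" "0 \<le> b"
    by (cases "SUP z. ennreal ((norm (fourier_transform M z))\<^sup>2 * norm z powr t)") auto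
  show ?thesis
  proof (rule that[of "sqrt b + 1" t])
    show "0 < sqrt b + 1" using b by (simp add: add_nonneg_pos)
    show "s < t" by fact
    fix z :: 'a assume z: "z \<noteq> 0"
    have "ennreal ((norm (fourier_transform M z))\<^sup>2 * norm z powr t) \<le> ennreal b"
      unfolding b(1)[symmetric] by (rule SUP_upper) simp
    then have "(norm (fourier_transform M z))\<^sup>2 * norm z powr t \<le> b" using b by simp
    then have "sqrt ((norm (fourier_transform M z))\<^sup>2 * norm z powr t) \<le> sqrt b" by (rule real_sqrt_le_mono)
    moreover have "sqrt ((norm (fourier_transform M z))\<^sup>2 * norm z powr t) = norm (fourier_transform M z) * norm z powr (t / 2)"
      by (simp add: real_sqrt_mult powr_half_sqrt[symmetric] powr_powr)
    ultimately have "norm (fourier_transform M z) * norm z powr (t / 2) \<le> sqrt b + 1" by simp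
    then have "norm (fourier_transform M z) * norm z powr (t / 2) * norm z powr (- (t / 2)) \<le> (sqrt b + 1) * norm z powr (- (t / 2))"
      by (rule mult_right_mono) simp
    then show "norm (fourier_transform M z) \<le> (sqrt b + 1) * norm z powr (- (t / 2))"
      using z by (simp add: mult.assoc powr_add[symmetric])
  qed
qed

text \<open>The exceptional null set depends on the exponent; rational exponents suffice, and there are
  countably many.\<close>

lemma pinned_hausdorff_dim_ge:
  assumes "DIM('a) \<ge> 2" and "compact (measure_support M)"
  shows "AE x in M. min (fourier_dim M / 2) 1 \<le> hausdorff_dim (pinned_distance_set x (measure_support M))"
proof -
  let ?L = "min (fourier_dim M / 2) 1"
  let ?h = "\<lambda>x. hausdorff_dim (pinned_distance_set x (measure_support M))"
  have "AE x in M. \<forall>r::rat. 0 < r \<and> ereal (of_rat r) < ?L \<longrightarrow> ereal (of_rat r) \<le> ?h x"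
    unfolding AE_all_countable
  proof
    fix r :: rat
    show "AE x in M. 0 < r \<and> ereal (of_rat r) < ?L \<longrightarrow> ereal (of_rat r) \<le> ?h x"
    proof (cases "0 < r \<and> ereal (of_rat r) < ?L")
      case True
      define v :: real where "v = of_rat r"
      have v: "0 < v" "v < 1" "ereal v < fourier_dim M / 2" using True by (auto simp: v_def one_ereal_def)
      have "ereal (2 * v) < fourier_dim M" using v(3) by (cases "fourier_dim M") auto
      then obtain C t where "0 < C" "2 * v < t"
        "\<And>z. z \<noteq> 0 \<Longrightarrow> norm (fourier_transform M z) \<le> C * norm z powr (- (t / 2))"
        using decay_of_less_fourier_dim by metis
      then have "AE x in M. ereal v \<le> ?h x"
        using v assms by (intro pinned_hausdorff_dim_ge_of_decay[where C=C and a="t/2"]) auto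
      then show ?thesis by (simp add: v_def)
    next
      case False
      then show ?thesis by (intro AE_I2) blast
    qed
  qed
  then show ?thesis
  proof eventually_elim
    case (elim x)
    show ?case
    proof (rule ccontr)
      assume "\<not> ?L \<le> ?h x"
      then have "?h x < ?L" by (simp only: not_le)
      from ereal_dense3[OF this] obtain r where r: "?h x < ereal (real_of_rat r)" "ereal (real_of_rat r) < ?L"
        by blast
      have "0 < ereal (real_of_rat r)" using hausdorff_dim_nonneg r(1) by (rule le_less_trans)
      then have "0 < r" by simp
      with elim r(2) have "ereal (real_of_rat r) \<le> ?h x" by blast
      with r(1) show False by simp
    qed
  qed
qed

lemma pinned_emeasure_pos:
  assumes "DIM('a) \<ge> 2" and "compact (measure_support M)" and "2 < fourier_dim M"
  shows "AE x in M. 0 < emeasure lebesgue (pinned_distance_set x (measure_support M))"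
proof -
  have "ereal 2 < fourier_dim M" using assms(3) by simp
  then obtain C t where "0 < C" "2 < t"
    "\<And>z. z \<noteq> 0 \<Longrightarrow> norm (fourier_transform M z) \<le> C * norm z powr (- (t / 2))"
    using decay_of_less_fourier_dim by metis
  then show ?thesis
    using assms by (intro pinned_emeasure_pos_of_decay[where C=C and a="t/2"]) auto
qed

end

section \<open>The Fourier spectrum bounds the Fourier dimension from below\<close>

context borel_prob_space begin

text \<open>The \<open>k\<close>-th difference with step \<open>h\<close> is the Fourier transform of \<open>(1 - exp (-2 \<pi> i h \<bullet> y))\<^sup>k\<close>
  times the measure, and the base is at most \<open>2 \<pi> R |h|\<close> on the support.\<close>

lemma norm_finite_difference_fourier_transform_le:
  assumes "AE y in M. norm y \<le> R" "0 \<le> R"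
  shows "norm (\<Sum>j\<le>k. of_nat (k choose j) * (- 1) ^ j * fourier_transform M (z + real j *\<^sub>R h))
    \<le> (2 * pi * R * norm h) ^ k"
proof -
  define e where "e v y = exp (- (2 * of_real pi * \<i> * of_real (v \<bullet> y)))" for v y :: 'a
  have em [measurable]: "e v \<in> borel_measurable borel" for v unfolding e_def by measurable
  have en: "norm (e v y) = 1" for v y by (simp add: e_def)
  have ie: "integrable M (e v)" for v
    by (rule integrable_const_bound[where B=1]) (auto simp: en)
  have e_add: "e (z + real j *\<^sub>R h) y = e z y * e h y ^ j" for j y
    by (simp add: e_def inner_add_left exp_add[symmetric] exp_of_nat_mult[symmetric] algebra_simps)
  have "(\<Sum>j\<le>k. of_nat (k choose j) * (- 1) ^ j * fourier_transform M (z + real j *\<^sub>R h))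
     = (\<Sum>j\<le>k. CLINT y|M. of_nat (k choose j) * (- 1) ^ j * e (z + real j *\<^sub>R h) y)"
    by (simp add: fourier_transform_def e_def)
  also have "\<dots> = (CLINT y|M. \<Sum>j\<le>k. of_nat (k choose j) * (- 1) ^ j * e (z + real j *\<^sub>R h) y)"
    by (rule Bochner_Integration.integral_sum[symmetric]) (auto intro: ie)
  also have "\<dots> = (CLINT y|M. e z y * (1 - e h y) ^ k)"
  proof (rule Bochner_Integration.integral_cong[OF refl])
    fix y
    have "(\<Sum>j\<le>k. of_nat (k choose j) * (- 1) ^ j * e (z + real j *\<^sub>R h) y)
      = e z y * (\<Sum>j\<le>k. of_nat (k choose j) * (- e h y) ^ j * 1 ^ (k - j))"
      unfolding e_add sum_distrib_left by (intro sum.cong refl) (simp add: power_minus[of "e h y"] mult_ac)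
    also have "\<dots> = e z y * (1 - e h y) ^ k"
      by (subst binomial_ring[symmetric]) simp
    finally show "(\<Sum>j\<le>k. of_nat (k choose j) * (- 1) ^ j * e (z + real j *\<^sub>R h) y) = e z y * (1 - e h y) ^ k" .
  qed
  also have "norm \<dots> \<le> (LINT y|M. norm (e z y * (1 - e h y) ^ k))" by (rule integral_norm_bound)
  also have "\<dots> \<le> (LINT y|M. (2 * pi * R * norm h) ^ k)"
  proof (rule integral_mono_AE)
    have b: "norm (1 - e h y) \<le> 2" for y using norm_triangle_ineq4[of 1 "e h y"] by (simp add: en)
    show "integrable M (\<lambda>y. norm (e z y * (1 - e h y) ^ k))"
      by (rule integrable_const_bound[where B="2 ^ k"])
         (auto simp: norm_mult norm_power en intro!: power_mono b)
    show "AE y in M. norm (e z y * (1 - e h y) ^ k) \<le> (2 * pi * R * norm h) ^ k"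
      using assms(1)
    proof eventually_elim
      case (elim y)
      have eh: "e h y = exp (\<i> * of_real (- (2 * pi * (h \<bullet> y))))" by (simp add: e_def mult_ac)
      have "norm (1 - e h y) = 2 * \<bar>sin (- (2 * pi * (h \<bullet> y)) / 2)\<bar>"
        unfolding eh using dist_exp_i_1[of "- (2 * pi * (h \<bullet> y))"] by (simp add: norm_minus_commute)
      also have "\<dots> \<le> 2 * \<bar>- (2 * pi * (h \<bullet> y)) / 2\<bar>"
        by (intro mult_left_mono abs_sin_x_le_abs_x) auto
      also have "\<dots> = 2 * pi * \<bar>h \<bullet> y\<bar>" by (simp add: abs_mult)
      also have "\<dots> \<le> 2 * pi * (norm h * norm y)"
        by (intro mult_left_mono Cauchy_Schwarz_ineq2) auto
      also have "\<dots> \<le> 2 * pi * (norm h * R)" using elim by (intro mult_left_mono) auto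
      finally have "norm (1 - e h y) \<le> 2 * pi * R * norm h" by (simp add: mult_ac)
      then show ?case by (simp add: norm_mult norm_power en power_mono)
    qed
  qed simp
  also have "\<dots> = (2 * pi * R * norm h) ^ k" using prob_space by simp
  finally show ?thesis .
qed

text \<open>When the \<open>k\<close>-th difference is at most half of \<open>|\<mu>^(z)|\<close>, the other terms must make up for the rest, and
  their binomial weights sum to less than \<open>2\<^sup>k\<close>. Some term is thus large, whatever the direction of \<open>h\<close>.\<close>

lemma fourier_transform_large_nearby:
  assumes "AE y in M. norm y \<le> R" "0 \<le> R" and "0 < k" "0 \<le> p"
    and h: "(2 * pi * R * norm h) ^ k \<le> norm (fourier_transform M z) / 2"
  shows "(norm (fourier_transform M z) / 2 ^ (k + 1)) powr p
    \<le> (\<Sum>j=1..k. norm (fourier_transform M (z + real j *\<^sub>R h)) powr p)"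
proof -
  define m where "m = norm (fourier_transform M z)"
  define f where "f j = norm (fourier_transform M (z + real j *\<^sub>R h))" for j
  have "\<exists>j\<in>{1..k}. m / 2 ^ (k + 1) \<le> f j"
  proof (rule ccontr)
    assume "\<not> ?thesis"
    then have lt: "f j < m / 2 ^ (k + 1)" if "j \<in> {1..k}" for j using that by force
    let ?F = "\<lambda>j. of_nat (k choose j) * (- 1) ^ j * fourier_transform M (z + real j *\<^sub>R h)"
    have "(\<Sum>j\<le>k. ?F j) = fourier_transform M z + (\<Sum>j=1..k. ?F j)"
      by (subst sum.atMost_shift) (simp add: sum.atLeast1_atMost_eq lessThan_Suc_atMost[symmetric])
    then have *: "fourier_transform M z = (\<Sum>j\<le>k. ?F j) - (\<Sum>j=1..k. ?F j)" by (simp only: add_diff_cancel_right')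
    have "m \<le> norm (\<Sum>j\<le>k. ?F j) + norm (\<Sum>j=1..k. ?F j)"
      unfolding m_def by (subst *) (rule norm_triangle_ineq4)
    also have "norm (\<Sum>j\<le>k. ?F j) \<le> m / 2"
      using norm_finite_difference_fourier_transform_le[OF assms(1,2), of k z h] h by (simp add: m_def)
    also have "norm (\<Sum>j=1..k. ?F j) \<le> (\<Sum>j=1..k. real (k choose j) * f j)"
      by (rule order_trans[OF norm_sum]) (simp add: norm_mult norm_power f_def)
    also have "\<dots> < (\<Sum>j=1..k. real (k choose j) * (m / 2 ^ (k + 1)))"
      using assms(3) lt by (intro sum_strict_mono mult_strict_left_mono) auto
    also have "\<dots> = (\<Sum>j=1..k. real (k choose j)) * (m / 2 ^ (k + 1))"
      by (rule sum_distrib_right[symmetric])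
    also have "\<dots> \<le> 2 ^ k * (m / 2 ^ (k + 1))"
    proof (rule mult_right_mono)
      have "(\<Sum>j=1..k. real (k choose j)) \<le> (\<Sum>j\<le>k. real (k choose j))"
        by (intro sum_mono2) auto
      also have "\<dots> = 2 ^ k"
        using choose_row_sum[of k] by (metis of_nat_numeral of_nat_power of_nat_sum)
      finally show "(\<Sum>j=1..k. real (k choose j)) \<le> 2 ^ k" .
    qed (simp add: m_def)
    also have "\<dots> = m / 2" by simp
    finally show False by simp
  qed
  then obtain j where j: "j \<in> {1..k}" "m / 2 ^ (k + 1) \<le> f j" by blast
  have "(m / 2 ^ (k + 1)) powr p \<le> f j powr p"
    using j assms by (intro powr_mono2) (auto simp: m_def)
  also have "\<dots> \<le> (\<Sum>j=1..k. f j powr p)"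
    using j by (intro member_le_sum) auto
  finally show ?thesis by (simp add: m_def f_def)
qed

text \<open>The largeness at \<open>z + j h\<close> is integrated over all steps \<open>h\<close> with \<open>|h| < r\<close>, where \<open>r\<close> is of order
  \<open>m\<^sup>1\<^sup>/\<^sup>k\<close> for \<open>m = |\<mu>^(z)|\<close>. The volume \<open>r\<^sup>d\<close> of this ball is the source of the extra exponent \<open>d/k\<close>. The
  points stay within distance 1 of \<open>z\<close>, so the weight there is comparable to \<open>|z|\<^sup>\<gamma>\<close>.\<close>

lemma fourier_transform_decay_of_weighted_integral:
  assumes R: "AE y in M. norm y \<le> R" and k: "0 < k" and p: "0 < p" and \<gamma>: "0 \<le> \<gamma>"
    and fin: "(\<integral>\<^sup>+z. ennreal (norm (fourier_transform M z) powr p * norm z powr \<gamma>) \<partial>lborel) < \<infinity>"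
  obtains C where "0 \<le> C" and
    "\<And>z. 2 \<le> norm z \<Longrightarrow> norm (fourier_transform M z) powr (p + real DIM('a) / real k) \<le> C * norm z powr (- \<gamma>)"
proof -
  let ?F = "fourier_transform M"
  define w where "w z = ennreal (norm (?F z) powr p * norm z powr \<gamma>)" for z
  have wm [measurable]: "w \<in> borel_measurable borel" unfolding w_def by measurable
  obtain J where J: "(\<integral>\<^sup>+z. w z \<partial>lborel) = ennreal J" "0 \<le> J"
    using fin unfolding w_def by (cases "\<integral>\<^sup>+z. w z \<partial>lborel") (auto simp: w_def)
  \<comment> \<open>Enlarging the radius to at least \<open>k\<close> makes \<open>k r \<le> 1\<close> for the step size \<open>r\<close> below.\<close>
  define R' where "R' = max R (real k)"
  have R': "AE y in M. norm y \<le> R'" "0 < R'" "real k \<le> 2 * pi * R'"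
  proof -
    show "AE y in M. norm y \<le> R'" using R by eventually_elim (simp add: R'_def)
    show "0 < R'" using k by (simp add: R'_def)
    have "1 * real k \<le> (2 * pi) * R'" using pi_gt3 by (intro mult_mono) (auto simp: R'_def)
    then show "real k \<le> 2 * pi * R'" by simp
  qed
  let ?d = "DIM('a)"
  define V where "V = unit_ball_vol (real ?d) / (2 * pi * R') ^ ?d"
  have V: "0 < V" using R' by (simp add: V_def)
  define B where "B = (2 ^ (k + 1)) powr p * 2 powr (real ?d / real k) / V * (real k * J * 2 powr \<gamma>)"
  show ?thesis
  proof (rule that[of B])
    show "0 \<le> B" using V J by (simp add: B_def)
    fix z :: 'a assume z: "2 \<le> norm z"
    define m where "m = norm (?F z)"
    have m1: "m \<le> 1" unfolding m_def by (rule norm_fourier_transform_le_1)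
    show "m powr (p + real ?d / real k) \<le> B * norm z powr (- \<gamma>)"
    proof (cases "m = 0")
      case True
      then show ?thesis using \<open>0 \<le> B\<close> by simp
    next
      case False
      then have m: "0 < m" by (simp add: m_def)
      define r where "r = (m / 2) powr (1 / real k) / (2 * pi * R')"
      have r: "0 < r" using m R' by (simp add: r_def)
      have "(m / 2) powr (1 / real k) \<le> 1" using m m1 by (intro powr_le1) auto
      then have rk: "real k * r \<le> 1" 
      proof -
        have "real k / (2 * pi * R') \<le> 1" using R' by (simp add: pos_divide_le_eq)
        then have "real k / (2 * pi * R') * (m / 2) powr (1 / real k) \<le> 1 * 1"
          using \<open>(m / 2) powr (1 / real k) \<le> 1\<close> by (intro mult_mono) auto
        then show ?thesis by (simp add: r_def)
      qed
      have small: "(2 * pi * R' * norm h) ^ k \<le> m / 2" if "norm h \<le> r" for h :: 'a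
      proof -
        have "2 * pi * R' * norm h \<le> 2 * pi * R' * r" using that R' by (intro mult_left_mono) auto
        also have "\<dots> = (m / 2) powr (1 / real k)" using R' by (simp add: r_def)
        finally have "(2 * pi * R' * norm h) ^ k \<le> ((m / 2) powr (1 / real k)) ^ k"
          using R' by (intro power_mono) auto
        also have "\<dots> = m / 2" using m k by (simp add: powr_realpow[symmetric] powr_powr)
        finally show ?thesis .
      qed
      have far: "norm z / 2 \<le> norm (z + real j *\<^sub>R h)" if "norm h \<le> r" "j \<le> k" for h :: 'a and j
      proof -
        have "norm (real j *\<^sub>R h) \<le> real k * r" using that by (simp add: mult_mono)
        with rk have "norm (real j *\<^sub>R h) \<le> 1" by linarith
        moreover have "norm z - norm (real j *\<^sub>R h) \<le> norm (z + real j *\<^sub>R h)"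
          by (metis norm_diff_ineq)
        ultimately show ?thesis using z by linarith
      qed
      have "ennreal ((m / 2 ^ (k + 1)) powr p) * emeasure lborel (ball (0::'a) r)
         = (\<integral>\<^sup>+h. ennreal ((m / 2 ^ (k + 1)) powr p) * indicator (ball (0::'a) r) h \<partial>lborel)"
        by (rule nn_integral_cmult_indicator[symmetric]) simp
      also have "\<dots> \<le> (\<integral>\<^sup>+h. ennreal ((norm z / 2) powr (- \<gamma>)) * (\<Sum>j=1..k. w (z + real j *\<^sub>R h)) \<partial>lborel)"
      proof (rule nn_integral_mono)
        fix h :: 'a
        show "ennreal ((m / 2 ^ (k + 1)) powr p) * indicator (ball 0 r) h
          \<le> ennreal ((norm z / 2) powr (- \<gamma>)) * (\<Sum>j=1..k. w (z + real j *\<^sub>R h))"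
        proof (cases "norm h < r")
          case True
          have "(m / 2 ^ (k + 1)) powr p \<le> (\<Sum>j=1..k. norm (?F (z + real j *\<^sub>R h)) powr p)"
            using R' k p small[of h] True unfolding m_def by (intro fourier_transform_large_nearby) auto
          also have "\<dots> \<le> (\<Sum>j=1..k. (norm z / 2) powr (- \<gamma>) *
              (norm (?F (z + real j *\<^sub>R h)) powr p * norm (z + real j *\<^sub>R h) powr \<gamma>))"
          proof (rule sum_mono)
            fix j assume j: "j \<in> {1..k}"
            have "1 = (norm z / 2) powr (- \<gamma>) * (norm z / 2) powr \<gamma>"
              using z by (subst powr_add[symmetric]) auto
            also have "\<dots> \<le> (norm z / 2) powr (- \<gamma>) * norm (z + real j *\<^sub>R h) powr \<gamma>"
              using far[of h j] True j \<gamma> by (intro mult_left_mono powr_mono2) auto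
            finally have "norm (?F (z + real j *\<^sub>R h)) powr p * 1
              \<le> norm (?F (z + real j *\<^sub>R h)) powr p * ((norm z / 2) powr (- \<gamma>) * norm (z + real j *\<^sub>R h) powr \<gamma>)"
              by (intro mult_left_mono) auto
            then show "norm (?F (z + real j *\<^sub>R h)) powr p \<le> (norm z / 2) powr (- \<gamma>) *
              (norm (?F (z + real j *\<^sub>R h)) powr p * norm (z + real j *\<^sub>R h) powr \<gamma>)"
              by (simp only: mult_1_right mult_ac)
          qed
          finally have "ennreal ((m / 2 ^ (k + 1)) powr p) \<le> ennreal (\<Sum>j=1..k. (norm z / 2) powr (- \<gamma>) *
              (norm (?F (z + real j *\<^sub>R h)) powr p * norm (z + real j *\<^sub>R h) powr \<gamma>))"
            by (rule ennreal_leI)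
          also have "\<dots> = ennreal ((norm z / 2) powr (- \<gamma>)) * (\<Sum>j=1..k. w (z + real j *\<^sub>R h))"
            unfolding w_def sum_distrib_left[symmetric]
            by (subst sum_ennreal) (auto simp: ennreal_mult sum_nonneg)
          finally show ?thesis using True by simp
        qed simp
      qed
      also have "\<dots> = ennreal ((norm z / 2) powr (- \<gamma>)) * (\<Sum>j=1..k. \<integral>\<^sup>+h. w (z + real j *\<^sub>R h) \<partial>lborel)"
        by (simp add: nn_integral_cmult nn_integral_sum)
      also have "\<dots> \<le> ennreal ((norm z / 2) powr (- \<gamma>)) * (\<Sum>j=1..k. ennreal J)"
      proof (intro mult_left_mono sum_mono)
        fix j assume j: "j \<in> {1..k}"
        \<comment> \<open>The substitution \<open>x = z + j h\<close> has Jacobian \<open>j\<^sup>d \<ge> 1\<close>.\<close>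
        have "1 * (\<integral>\<^sup>+h. w (z + real j *\<^sub>R h) \<partial>lborel) \<le> ennreal (real j ^ ?d) * (\<integral>\<^sup>+h. w (z + real j *\<^sub>R h) \<partial>lborel)"
          using j by (intro mult_right_mono) auto
        also have "\<dots> = (\<integral>\<^sup>+x. w x \<partial>lborel)"
          using j by (subst (2) lborel_affine[of "real j" z])
            (auto simp: nn_integral_density nn_integral_distr nn_integral_cmult)
        finally show "(\<integral>\<^sup>+h. w (z + real j *\<^sub>R h) \<partial>lborel) \<le> ennreal J" using J by simp
      qed auto
      also have "\<dots> = ennreal ((norm z / 2) powr (- \<gamma>) * (real k * J))"
        using J by (simp add: ennreal_mult ennreal_of_nat_eq_real_of_nat)
      also have "emeasure lborel (ball (0::'a) r) = ennreal (unit_ball_vol (real ?d) * r ^ ?d)"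
        using r by (intro emeasure_ball) simp
      finally have "ennreal ((m / 2 ^ (k + 1)) powr p * (unit_ball_vol (real ?d) * r ^ ?d))
         \<le> ennreal ((norm z / 2) powr (- \<gamma>) * (real k * J))"
        using r by (simp add: ennreal_mult)
      then have main: "(m / 2 ^ (k + 1)) powr p * (unit_ball_vol (real ?d) * r ^ ?d)
         \<le> (norm z / 2) powr (- \<gamma>) * (real k * J)"
        using J by (subst (asm) ennreal_le_iff) auto
      have "r ^ ?d = (m / 2) powr (real ?d / real k) / (2 * pi * R') ^ ?d"
        using m k by (simp add: r_def power_divide powr_realpow[symmetric] powr_powr)
      then have "unit_ball_vol (real ?d) * r ^ ?d = V * (m / 2) powr (real ?d / real k)"
        by (simp add: V_def)
      with main have main': "(m / 2 ^ (k + 1)) powr p * (V * (m / 2) powr (real ?d / real k))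
         \<le> (norm z / 2) powr (- \<gamma>) * (real k * J)" by simp
      define A where "A = (2 ^ (k + 1)) powr p * 2 powr (real ?d / real k) / V"
      have A: "0 < A" using V by (simp add: A_def)
      have "m powr (p + real ?d / real k) = A * ((m / 2 ^ (k + 1)) powr p * (V * (m / 2) powr (real ?d / real k)))"
        using V by (simp add: A_def powr_divide powr_add)
      also have "\<dots> \<le> A * ((norm z / 2) powr (- \<gamma>) * (real k * J))"
        using A main' by (intro mult_left_mono) auto
      also have "(norm z / 2) powr (- \<gamma>) = 2 powr \<gamma> * norm z powr (- \<gamma>)"
        by (simp add: powr_divide powr_minus_divide)
      also have "A * (2 powr \<gamma> * norm z powr (- \<gamma>) * (real k * J)) = B * norm z powr (- \<gamma>)"
        by (simp add: B_def A_def)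
      finally show ?thesis .
    qed
  qed
qed

lemma fourier_dim_nonneg: "0 \<le> fourier_dim M"
proof -
  have "(SUP z. ennreal ((norm (fourier_transform M z))\<^sup>2 * norm z powr 0)) \<le> 1"
  proof (rule SUP_least)
    fix z
    have "(norm (fourier_transform M z))\<^sup>2 * norm z powr 0 \<le> 1 * 1"
      using norm_fourier_transform_le_1[of z] by (intro mult_mono) (auto simp: power_le_one)
    then show "ennreal ((norm (fourier_transform M z))\<^sup>2 * norm z powr 0) \<le> 1" by (simp only: mult_1 ennreal_le_1)
  qed
  also have "1 < (\<infinity>::ennreal)" by simp
  finally show ?thesis
    unfolding fourier_dim_def by (intro Sup_upper) (auto intro!: exI[of _ 0] simp: zero_ereal_def)
qed

text \<open>For each \<open>k\<close> the previous lemma gives the decay exponent \<open>t k = 2 \<gamma> / (p + d / (k + 1))\<close>, and these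
  tend to \<open>2 \<gamma> / p = s - d \<theta>\<close>.\<close>

lemma fourier_dim_ge_of_energy:
  assumes R: "AE y in M. norm y \<le> R" and \<theta>: "0 < \<theta>"
    and s: "real DIM('a) * \<theta> < s" and fin: "fourier_energy s \<theta> M < \<infinity>"
  shows "ereal (s - real DIM('a) * \<theta>) \<le> fourier_dim M"
proof -
  let ?F = "fourier_transform M"
  define p where "p = 2 / \<theta>"
  define \<gamma> where "\<gamma> = s / \<theta> - real DIM('a)"
  have p: "0 < p" using \<theta> by (simp add: p_def)
  have \<gamma>: "0 < \<gamma>" using \<theta> s by (simp add: \<gamma>_def field_simps)
  have J: "(\<integral>\<^sup>+z. ennreal (norm (?F z) powr p * norm z powr \<gamma>) \<partial>lborel) < \<infinity>"
    using fin by (auto simp: fourier_energy_def fourier_energy_integral_def p_def \<gamma>_def less_top split: if_splits)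
  define t where "t k = 2 * \<gamma> / (p + real DIM('a) / real (Suc k))" for k
  have t_le: "ereal (t k) \<le> fourier_dim M" for k
  proof -
    define P where "P = p + real DIM('a) / real (Suc k)"
    have P: "0 < P" using p by (simp add: P_def add_pos_nonneg)
    have t: "0 \<le> t k" "t k = 2 * \<gamma> / P" using \<gamma> P by (auto simp: t_def P_def)
    obtain C where C: "0 \<le> C" "\<And>z. 2 \<le> norm z \<Longrightarrow> norm (?F z) powr P \<le> C * norm z powr (- \<gamma>)"
      using fourier_transform_decay_of_weighted_integral[OF R _ p _ J, of "Suc k"] \<gamma> unfolding P_def by auto
    define D where "D = max (2 powr t k) (C powr (2 / P))"
    have bound: "(norm (?F z))\<^sup>2 * norm z powr t k \<le> D" for z
    proof (cases "2 \<le> norm z")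
      case True
      have "(norm (?F z) powr P) powr (2 / P) \<le> (C * norm z powr (- \<gamma>)) powr (2 / P)"
        using C(2)[OF True] P by (intro powr_mono2) auto
      moreover have "(norm (?F z) powr P) powr (2 / P) = (norm (?F z))\<^sup>2"
        using P by (cases "?F z = 0") (simp_all add: powr_powr)
      moreover have "(C * norm z powr (- \<gamma>)) powr (2 / P) = C powr (2 / P) * norm z powr (- t k)"
        using C(1) by (simp add: powr_mult powr_powr t mult.commute)
      ultimately have "(norm (?F z))\<^sup>2 * norm z powr t k \<le> C powr (2 / P) * norm z powr (- t k) * norm z powr t k"
        by (intro mult_right_mono) auto
      also have "\<dots> = C powr (2 / P)" 
      proof -
        have "z \<noteq> 0" using True by auto
        then show ?thesis by (simp add: mult.assoc powr_add[symmetric])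
      qed
      finally show ?thesis by (simp add: D_def)
    next
      case False
      have "(norm (?F z))\<^sup>2 * norm z powr t k \<le> 1 * 2 powr t k"
        using norm_fourier_transform_le_1[of z] False t
        by (intro mult_mono powr_mono2) (auto simp: power_le_one)
      then show ?thesis by (simp add: D_def)
    qed
    have "(SUP z. ennreal ((norm (?F z))\<^sup>2 * norm z powr t k)) \<le> ennreal D"
      using bound by (intro SUP_least ennreal_leI)
    also have "\<dots> < \<infinity>" by simp
    finally show ?thesis unfolding fourier_dim_def using t by (intro Sup_upper) auto
  qed
  have "(\<lambda>k. real DIM('a) / real (Suc k)) \<longlonglongrightarrow> 0"
    using tendsto_mult_left[OF LIMSEQ_inverse_real_of_nat, of "real DIM('a)"] by (simp add: divide_inverse)
  then have "t \<longlonglongrightarrow> 2 * \<gamma> / (p + 0)"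
    unfolding t_def[abs_def] using p by (intro tendsto_intros) auto
  also have "2 * \<gamma> / (p + 0) = s - real DIM('a) * \<theta>"
    using \<theta> by (simp add: p_def \<gamma>_def field_simps)
  finally have "(\<lambda>k. ereal (t k)) \<longlonglongrightarrow> ereal (s - real DIM('a) * \<theta>)" by simp
  then show ?thesis using t_le by (intro LIMSEQ_le_const2) blast+
qed

lemma fourier_spectrum_le_fourier_dim:
  assumes R: "AE y in M. norm y \<le> R" and \<theta>: "0 < \<theta>"
  shows "fourier_spectrum \<theta> M - ereal (real DIM('a) * \<theta>) \<le> fourier_dim M"
proof -
  have "fourier_spectrum \<theta> M \<le> fourier_dim M + ereal (real DIM('a) * \<theta>)"
    unfolding fourier_spectrum_def
  proof (rule Sup_least)
    fix x assume "x \<in> insert 0 {ereal s |s. 0 \<le> s \<and> fourier_energy s \<theta> M < \<infinity>}"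
    then consider "x = 0" | s where "x = ereal s" "fourier_energy s \<theta> M < \<infinity>" by blast
    then show "x \<le> fourier_dim M + ereal (real DIM('a) * \<theta>)"
    proof cases
      case 1
      then show ?thesis using fourier_dim_nonneg \<theta> by (simp add: add_nonneg_nonneg)
    next
      case 2
      have "ereal (s - real DIM('a) * \<theta>) \<le> fourier_dim M"
      proof (cases "real DIM('a) * \<theta> < s")
        case True
        then show ?thesis using fourier_dim_ge_of_energy[OF R \<theta> _ 2(2)] by simp
      next
        case False
        then have "ereal (s - real DIM('a) * \<theta>) \<le> 0" by (simp add: zero_ereal_def)
        then show ?thesis using fourier_dim_nonneg by (rule order_trans)
      qed
      then have "ereal (s - real DIM('a) * \<theta>) + ereal (real DIM('a) * \<theta>) \<le> fourier_dim M + ereal (real DIM('a) * \<theta>)"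
        by (rule add_right_mono)
      then show ?thesis using 2 by simp
    qed
  qed
  then show ?thesis by (subst ereal_minus_le_iff) (auto simp: add.commute)
qed

end

section \<open>Pinned distance sets, the Fourier dimension and the Fourier spectrum\<close>

theorem theorem2p4:
  fixes \<mu> :: "(real ^ 'n) measure"
  assumes "CARD('n) \<ge> 2"
    and "prob_space \<mu>"
    and "sets \<mu> = sets borel"
    and "compact (measure_support \<mu>)"
  shows
    "((AE x in \<mu>. hausdorff_dim (pinned_distance_set x (measure_support \<mu>))
                    \<ge> min (fourier_dim \<mu> / 2) 1)
      \<and> (fourier_dim \<mu> > 2 \<longrightarrow>
          (AE x in \<mu>. emeasure lebesgue (pinned_distance_set x (measure_support \<mu>)) > 0)))
     \<and>
     (\<forall>\<theta>::real. 0 < \<theta> \<and> \<theta> \<le> 1 \<longrightarrow>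
        (AE x in \<mu>. hausdorff_dim (pinned_distance_set x (measure_support \<mu>))
                      \<ge> min ((fourier_spectrum \<theta> \<mu> - ereal (real CARD('n) * \<theta>)) / 2) 1)
        \<and> (fourier_spectrum \<theta> \<mu> > 2 + ereal (real CARD('n) * \<theta>) \<longrightarrow>
            (AE x in \<mu>. emeasure lebesgue (pinned_distance_set x (measure_support \<mu>)) > 0)))"
proof -
  interpret borel_prob_space \<mu>
    by (intro borel_prob_space.intro borel_prob_space_axioms.intro assms)
  have D2: "DIM(real ^ 'n) \<ge> 2" using assms(1) by simp
  obtain R where "\<forall>y\<in>measure_support \<mu>. norm y \<le> R"
    using compact_imp_bounded[OF assms(4)] unfolding bounded_iff by blast
  then have R: "AE y in \<mu>. norm y \<le> R"
    using AE_measure_support by (auto elim: eventually_mono)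
  note dimension = pinned_hausdorff_dim_ge[OF D2 assms(4)]
  note positive = pinned_emeasure_pos[OF D2 assms(4)]
  have spectrum: "fourier_spectrum \<theta> \<mu> - ereal (real CARD('n) * \<theta>) \<le> fourier_dim \<mu>" if "0 < \<theta>" for \<theta>
    using fourier_spectrum_le_fourier_dim[OF R that] by simp
  have part2_dim: "AE x in \<mu>. hausdorff_dim (pinned_distance_set x (measure_support \<mu>))
                      \<ge> min ((fourier_spectrum \<theta> \<mu> - ereal (real CARD('n) * \<theta>)) / 2) 1" if "0 < \<theta>" for \<theta>
  proof -
    have *: "min ((fourier_spectrum \<theta> \<mu> - ereal (real CARD('n) * \<theta>)) / 2) 1 \<le> min (fourier_dim \<mu> / 2) 1"
      using spectrum[OF that] by (intro min.mono ereal_divide_right_mono) auto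
    show ?thesis by (rule eventually_mono[OF dimension]) (rule order_trans[OF *])
  qed
  have part2_pos: "fourier_dim \<mu> > 2"
    if "0 < \<theta>" "fourier_spectrum \<theta> \<mu> > 2 + ereal (real CARD('n) * \<theta>)" for \<theta>
  proof -
    have "2 < fourier_spectrum \<theta> \<mu> - ereal (real CARD('n) * \<theta>)"
      using that(2) by (cases "fourier_spectrum \<theta> \<mu>") auto
    then show ?thesis using spectrum[OF that(1)] by (rule less_le_trans)
  qed
  show ?thesis
    using dimension positive part2_dim part2_pos by blast
qed

end
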